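(* Let $d,n$ be positive integers and let $F_{d,n}=F_{d,n}(l,m,y_0,\ldots,y_{d-1})$ be the $d$-framization of the BMW algebra over $K=\mathbb{C}(l,m)$. Then $F_{d,n}$ is finite dimensional (as a $K$-vector space).
   Context: Let $K=\mathbb{C}(l,m)$ be the field of rational functions in two indeterminates $l,m$, and put $y:=1+\frac{l^{-1}-l}{m}\in K$. Let $d,n$ be positive integers, $y_0:=y$, and let $y_1,\ldots,y_{d-1}$ be unspecified parameters (fixed scalars in the ground field). The algebra $F_{d,n}=F_{d,n}(l,m,y_0,\ldots,y_{d-1})$ is the unital associative $K$-algebra with generators $g_1,\ldots,g_{n-1}$, $h_1,\ldots,h_{n-1}$, $t_1,\ldots,t_n$ and the following defining relations (for all indices for which they make sense): - $g_ig_{i+1}g_i=g_{i+1}g_ig_{i+1}$, and $g_ig_j=g_jg_i$ for $|i-j|>1$; - $g_ih_i=l^{-1}h_i$; - $h_ig_{i\pm1}h_i=l\,h_i$; - $t_i^d=1$ and $t_it_j=t_jt_i$ for all $i,j$; - $t_ih_i=t_{i+1}h_i$ and $h_it_i=h_it_{i+1}$; - $h_it_i^kh_i=y_kh_i$ for $0\le k\le d-1$; - $t_jg_i=g_it_{s_i(j)}$ for all $i,j$, where $s_i$ is the transposition $(i,i+1)$; - $g_i^2=(1-m)-m\,e_i(g_i-1)+m\,l^{-1}h_i$, where $e_i:=\frac1d\sum_{s=0}^{d-1}t_i^s t_{i+1}^{-s}$. *)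

theory Defs
  imports
    "HOL-Library.Poly_Mapping"
    "HOL-Computational_Algebra.Polynomial_Factorial"
    "HOL-Combinatorics.Transposition"
    "HOL-Algebra.QuotRing"
    "Jordan_Normal_Form.VS_Connect"
begin

text \<open>
  The free monoid on \<open>'x\<close>, written additively: then the convolution product of
  finitely supported functions on it is the product of the free associative algebra.
\<close>

datatype 'x free_monoid = Word (letters: "'x list")

instantiation free_monoid :: (type) monoid_add
begin

definition zero_free_monoid :: "'a free_monoid" where
  "0 = Word []"

definition plus_free_monoid :: "'a free_monoid \<Rightarrow> 'a free_monoid \<Rightarrow> 'a free_monoid" where
  "u + v = Word (letters u @ letters v)"

instance
  by standard (simp_all add: zero_free_monoid_def plus_free_monoid_def)

end

type_synonym ('x, 'a) nc_poly = "'x free_monoid \<Rightarrow>\<^sub>0 'a"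

definition scalar :: "'a::comm_ring_1 \<Rightarrow> ('x, 'a) nc_poly" where
  "scalar c = Poly_Mapping.single 0 c"

definition var :: "'x \<Rightarrow> ('x, 'a::comm_ring_1) nc_poly" where
  "var x = Poly_Mapping.single (Word [x]) 1"

definition free_algebra :: "'x set \<Rightarrow> ('a::comm_ring_1, ('x, 'a) nc_poly) module" where
  "free_algebra X =
    \<lparr>carrier = {p. \<forall>w\<in>Poly_Mapping.keys p. set (letters w) \<subseteq> X},
     mult = (*), one = 1, zero = 0, add = (+), smult = (\<lambda>c p. scalar c * p)\<rparr>"

lemma free_algebra_simps [simp]:
  "p \<in> carrier (free_algebra X) \<longleftrightarrow> (\<forall>w\<in>Poly_Mapping.keys p. set (letters w) \<subseteq> X)"
  "mult (free_algebra X) = (*)" "one (free_algebra X) = 1"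
  "zero (free_algebra X) = 0" "add (free_algebra X) = (+)"
  "smult (free_algebra X) = (\<lambda>c p. scalar c * p)"
  by (simp_all add: free_algebra_def)

lemma free_algebra_closed:
  shows "scalar c \<in> carrier (free_algebra X)"
    and "x \<in> X \<Longrightarrow> var x \<in> carrier (free_algebra X)"
    and "0 \<in> carrier (free_algebra X)"
    and "1 \<in> carrier (free_algebra X)"
    and "p \<in> carrier (free_algebra X) \<Longrightarrow> - p \<in> carrier (free_algebra X)"
    and "p \<in> carrier (free_algebra X) \<Longrightarrow> q \<in> carrier (free_algebra X) \<Longrightarrow>
      p + q \<in> carrier (free_algebra X)"
    and "p \<in> carrier (free_algebra X) \<Longrightarrow> q \<in> carrier (free_algebra X) \<Longrightarrow>
      p - q \<in> carrier (free_algebra X)"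
    and "p \<in> carrier (free_algebra X) \<Longrightarrow> q \<in> carrier (free_algebra X) \<Longrightarrow>
      p * q \<in> carrier (free_algebra X)"
proof -
  show "p + q \<in> carrier (free_algebra X)"
    if "p \<in> carrier (free_algebra X)" "q \<in> carrier (free_algebra X)"
    using that Poly_Mapping.keys_add[of p q] by fastforce
  show "p - q \<in> carrier (free_algebra X)"
    if "p \<in> carrier (free_algebra X)" "q \<in> carrier (free_algebra X)"
    using that keys_diff[of p q] by fastforce
  show "p * q \<in> carrier (free_algebra X)"
    if "p \<in> carrier (free_algebra X)" "q \<in> carrier (free_algebra X)"
    unfolding free_algebra_simps
  proof
    fix w assume "w \<in> Poly_Mapping.keys (p * q)"
    then obtain u v where "w = u + v" "u \<in> Poly_Mapping.keys p" "v \<in> Poly_Mapping.keys q"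
      using Poly_Mapping.keys_mult[of p q] by auto
    then show "set (letters w) \<subseteq> X"
      using that by (auto simp: plus_free_monoid_def)
  qed
qed (auto simp: scalar_def var_def zero_free_monoid_def keys_minus)

lemma free_algebra_power_closed:
  "p \<in> carrier (free_algebra X) \<Longrightarrow> p ^ k \<in> carrier (free_algebra X)"
  by (induction k) (auto simp del: free_algebra_simps(1) intro: free_algebra_closed)

lemma free_algebra_sum_closed:
  "(\<And>a. a \<in> A \<Longrightarrow> f a \<in> carrier (free_algebra X)) \<Longrightarrow> sum f A \<in> carrier (free_algebra X)"
  by (induction A rule: infinite_finite_induct)
    (auto simp del: free_algebra_simps(1) intro: free_algebra_closed)

lemma ring_free_algebra: "ring (free_algebra X)"
proof (rule ringI)
  show "abelian_group (free_algebra X)"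
  proof (rule abelian_groupI)
    fix p assume "p \<in> carrier (free_algebra X)"
    then show "\<exists>q\<in>carrier (free_algebra X). q \<oplus>\<^bsub>free_algebra X\<^esub> p = \<zero>\<^bsub>free_algebra X\<^esub>"
      by (intro bexI[of _ "- p"] free_algebra_closed) simp_all
  qed (auto simp del: free_algebra_simps(1) intro: free_algebra_closed)
  show "monoid (free_algebra X)"
    by (rule monoidI)
      (auto simp del: free_algebra_simps(1) simp: mult.assoc intro: free_algebra_closed)
qed (auto simp: algebra_simps)

lemma scalar_add: "scalar (a + b) = scalar a + scalar b"
  by (simp add: scalar_def single_add)

lemma scalar_mult: "scalar (a * b) = scalar a * scalar b"
  by (simp add: scalar_def mult_single)

lemma scalar_1: "scalar 1 = 1"
  by (simp add: scalar_def)

text \<open>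
  The quotient ring \<open>A Quot I\<close>, whose elements are the cosets of \<open>I\<close>, together with
  the induced scalar multiplication.
\<close>

definition quotient_algebra ::
  "('a, 'b, 'c) module_scheme \<Rightarrow> 'b set \<Rightarrow> ('a, 'b set) module" where
  "quotient_algebra A I =
    \<lparr>carrier = carrier (A Quot I), mult = mult (A Quot I), one = one (A Quot I),
     zero = zero (A Quot I), add = add (A Quot I),
     smult = (\<lambda>c C. \<Union>x\<in>C. I +>\<^bsub>A\<^esub> (c \<odot>\<^bsub>A\<^esub> x))\<rparr>"

lemma smult_quotient_algebra:
  assumes "ideal I (free_algebra X)" "p \<in> carrier (free_algebra X)"
  shows "c \<odot>\<^bsub>quotient_algebra (free_algebra X) I\<^esub> (I +>\<^bsub>free_algebra X\<^esub> p) =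
    I +>\<^bsub>free_algebra X\<^esub> (scalar c * p)"
proof -
  let ?A = "free_algebra X"
  interpret ideal I ?A by fact
  have "I +>\<^bsub>?A\<^esub> (scalar c * x) = I +>\<^bsub>?A\<^esub> (scalar c * p)" if x: "x \<in> I +>\<^bsub>?A\<^esub> p" for x
  proof -
    have xc: "x \<in> carrier ?A"
      using x assms(2) a_r_coset_subset_G a_subset by blast
    have eq: "I +>\<^bsub>?A\<^esub> p = I +>\<^bsub>?A\<^esub> x"
      by (rule a_repr_independence[OF x assms(2) a_subgroup])
    show ?thesis
      using rcoset_mult_add[OF free_algebra_closed(1) xc, of c, folded eq]
        rcoset_mult_add[OF free_algebra_closed(1) assms(2), of c]
      unfolding free_algebra_simps by (rule trans[OF sym])
  qed
  moreover have "p \<in> I +>\<^bsub>?A\<^esub> p"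
    using assms(2) a_rcos_self by blast
  ultimately have "(\<Union>x\<in>I +>\<^bsub>?A\<^esub> p. I +>\<^bsub>?A\<^esub> (scalar c * x)) = I +>\<^bsub>?A\<^esub> (scalar c * p)"
    by blast
  then show ?thesis
    by (simp only: quotient_algebra_def module.simps free_algebra_simps)
qed

lemma ring_quotient_algebra:
  assumes "ideal I (free_algebra X)"
  shows "ring (quotient_algebra (free_algebra X) I)"
proof -
  let ?A = "free_algebra X"
  interpret ideal I ?A by fact
  interpret Q: ring "?A Quot I" by (rule quotient_is_ring)
  show ?thesis
  proof (rule ringI)
    show "abelian_group (quotient_algebra ?A I)"
      by (rule abelian_groupI)
        (auto simp: quotient_algebra_def Q.a_ac intro: Q.l_neg Q.a_inv_closed)
    show "monoid (quotient_algebra ?A I)"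
      by (rule monoidI) (auto simp: quotient_algebra_def Q.m_assoc)
  qed (auto simp: quotient_algebra_def Q.l_distr Q.r_distr)
qed

lemma vectorspace_quotient_algebra:
  fixes X :: "'x set" and I :: "('x, 'a::field) nc_poly set"
  assumes "ideal I (free_algebra X)"
  shows "vectorspace class_ring (quotient_algebra (free_algebra X) I)"
proof -
  let ?A = "free_algebra X :: ('a, ('x, 'a) nc_poly) module"
  let ?Q = "quotient_algebra ?A I"
  interpret ideal I ?A by fact
  interpret Q: ring ?Q by (rule ring_quotient_algebra) fact
  have carrier_Q: "carrier ?Q = {I +>\<^bsub>?A\<^esub> p |p. p \<in> carrier ?A}"
    unfolding quotient_algebra_def FactRing_def A_RCOSETS_def RCOSETS_def a_r_coset_def by auto
  have cosetE: "\<exists>p\<in>carrier ?A. C = I +>\<^bsub>?A\<^esub> p" if "C \<in> carrier ?Q" for C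
    using that unfolding carrier_Q by blast
  have coset: "I +>\<^bsub>?A\<^esub> p \<in> carrier ?Q" if "p \<in> carrier ?A" for p
    using that unfolding carrier_Q by blast
  have add: "(I +>\<^bsub>?A\<^esub> p) \<oplus>\<^bsub>?Q\<^esub> (I +>\<^bsub>?A\<^esub> q) = I +>\<^bsub>?A\<^esub> (p + q)"
    if "p \<in> carrier ?A" "q \<in> carrier ?A" for p q
    using a_rcos_sum[OF that] by (simp add: quotient_algebra_def FactRing_def)
  note smult = smult_quotient_algebra[OF assms]
  have closed: "scalar a * p \<in> carrier ?A" if "p \<in> carrier ?A" for a p
    using that free_algebra_closed(1,8) by blast
  have closed_add: "p + q \<in> carrier ?A" if "p \<in> carrier ?A" "q \<in> carrier ?A" for p q
    using that free_algebra_closed(6) by blast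
  have "module (class_ring :: 'a ring) ?Q"
  proof (rule Module.moduleI)
    show "cring (class_ring :: 'a ring)" by (rule class_cring.is_cring)
    show "abelian_group ?Q" by (rule Q.abelian_group_axioms)
  next
    fix a :: 'a and C assume "C \<in> carrier ?Q"
    then obtain p where p: "p \<in> carrier ?A" "C = I +>\<^bsub>?A\<^esub> p" using cosetE by blast
    show "a \<odot>\<^bsub>?Q\<^esub> C \<in> carrier ?Q"
      unfolding p(2) smult[OF p(1)] by (intro coset closed p)
  next
    fix a b :: 'a and C assume "C \<in> carrier ?Q"
    then obtain p where p: "p \<in> carrier ?A" "C = I +>\<^bsub>?A\<^esub> p" using cosetE by blast
    show "(a \<oplus>\<^bsub>class_ring\<^esub> b) \<odot>\<^bsub>?Q\<^esub> C = a \<odot>\<^bsub>?Q\<^esub> C \<oplus>\<^bsub>?Q\<^esub> b \<odot>\<^bsub>?Q\<^esub> C"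
      unfolding p(2) smult[OF p(1)] add[OF closed[OF p(1)] closed[OF p(1)]]
      by (simp add: scalar_add distrib_right)
  next
    fix a b :: 'a and C assume "C \<in> carrier ?Q"
    then obtain p where p: "p \<in> carrier ?A" "C = I +>\<^bsub>?A\<^esub> p" using cosetE by blast
    show "(a \<otimes>\<^bsub>class_ring\<^esub> b) \<odot>\<^bsub>?Q\<^esub> C = a \<odot>\<^bsub>?Q\<^esub> (b \<odot>\<^bsub>?Q\<^esub> C)"
      unfolding p(2) smult[OF p(1)] smult[OF closed[OF p(1)]]
      by (simp add: scalar_mult mult.assoc)
  next
    fix a :: 'a and C D assume "C \<in> carrier ?Q" "D \<in> carrier ?Q"
    then obtain p q where p: "p \<in> carrier ?A" "C = I +>\<^bsub>?A\<^esub> p"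
      and q: "q \<in> carrier ?A" "D = I +>\<^bsub>?A\<^esub> q" using cosetE by meson
    show "a \<odot>\<^bsub>?Q\<^esub> (C \<oplus>\<^bsub>?Q\<^esub> D) = a \<odot>\<^bsub>?Q\<^esub> C \<oplus>\<^bsub>?Q\<^esub> a \<odot>\<^bsub>?Q\<^esub> D"
      unfolding p(2) q(2) smult[OF p(1)] smult[OF q(1)] add[OF p(1) q(1)]
        add[OF closed[OF p(1)] closed[OF q(1)]] smult[OF closed_add[OF p(1) q(1)]]
      by (simp add: distrib_left)
  next
    fix C assume "C \<in> carrier ?Q"
    then obtain p where p: "p \<in> carrier ?A" "C = I +>\<^bsub>?A\<^esub> p" using cosetE by blast
    show "\<one>\<^bsub>class_ring\<^esub> \<odot>\<^bsub>?Q\<^esub> C = C"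
      using smult[OF p(1), of 1] by (simp add: p(2) scalar_1)
  qed
  then show ?thesis
    using class_field by (intro vectorspace.intro)
qed

definition presented_algebra ::
  "'x set \<Rightarrow> (('x, 'a) nc_poly \<times> ('x, 'a) nc_poly) set
    \<Rightarrow> ('a::comm_ring_1, ('x, 'a) nc_poly set) module" where
  "presented_algebra X R =
    quotient_algebra (free_algebra X) (Idl\<^bsub>free_algebra X\<^esub> {p - q |p q. (p, q) \<in> R})"

text \<open>\<open>\<complex>(l,m)\<close> as the fraction field of \<open>\<complex>[l][m]\<close>.\<close>

type_synonym ground = "complex poly poly fract"

definition l_var :: ground where
  "l_var = to_fract [:[:0, 1:]:]"

definition m_var :: ground where
  "m_var = to_fract [:0, 1:]"

definition y_bmw :: ground where
  "y_bmw = 1 + (inverse l_var - l_var) / m_var"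

datatype gen = Gen_g nat | Gen_h nat | Gen_t nat

definition F_gens :: "nat \<Rightarrow> gen set" where
  "F_gens n = Gen_g ` {1..n - 1} \<union> Gen_h ` {1..n - 1} \<union> Gen_t ` {1..n}"

type_synonym F_poly = "(gen, ground) nc_poly"

abbreviation gX :: "nat \<Rightarrow> F_poly" where "gX i \<equiv> var (Gen_g i)"
abbreviation hX :: "nat \<Rightarrow> F_poly" where "hX i \<equiv> var (Gen_h i)"
abbreviation tX :: "nat \<Rightarrow> F_poly" where "tX i \<equiv> var (Gen_t i)"

text \<open>
  In the free algebra \<open>tX j\<close> is not invertible; \<open>tX j ^ (d - 1)\<close> represents its inverse
  in any quotient where the relation \<open>tX j ^ d = 1\<close> holds.
\<close>

definition eX :: "nat \<Rightarrow> nat \<Rightarrow> F_poly" where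
  "eX d i = scalar (1 / of_nat d) * (\<Sum>s = 0..d - 1. tX i ^ s * (tX (i + 1) ^ (d - 1)) ^ s)"

inductive_set F_rels :: "nat \<Rightarrow> nat \<Rightarrow> (nat \<Rightarrow> ground) \<Rightarrow> (F_poly \<times> F_poly) set"
  for d n :: nat and y :: "nat \<Rightarrow> ground" where
  braid: "\<lbrakk>i \<in> {1..n - 1}; i + 1 \<in> {1..n - 1}\<rbrakk>
    \<Longrightarrow> (gX i * gX (i + 1) * gX i, gX (i + 1) * gX i * gX (i + 1)) \<in> F_rels d n y"
| far: "\<lbrakk>i \<in> {1..n - 1}; j \<in> {1..n - 1}; \<bar>int i - int j\<bar> > 1\<rbrakk>
    \<Longrightarrow> (gX i * gX j, gX j * gX i) \<in> F_rels d n y"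
| gh: "i \<in> {1..n - 1} \<Longrightarrow> (gX i * hX i, scalar (inverse l_var) * hX i) \<in> F_rels d n y"
| hgh: "\<lbrakk>i \<in> {1..n - 1}; j \<in> {1..n - 1}; j = i + 1 \<or> i = j + 1\<rbrakk>
    \<Longrightarrow> (hX i * gX j * hX i, scalar l_var * hX i) \<in> F_rels d n y"
| t_pow: "i \<in> {1..n} \<Longrightarrow> (tX i ^ d, 1) \<in> F_rels d n y"
| t_comm: "\<lbrakk>i \<in> {1..n}; j \<in> {1..n}\<rbrakk> \<Longrightarrow> (tX i * tX j, tX j * tX i) \<in> F_rels d n y"
| th: "i \<in> {1..n - 1} \<Longrightarrow> (tX i * hX i, tX (i + 1) * hX i) \<in> F_rels d n y"
| ht: "i \<in> {1..n - 1} \<Longrightarrow> (hX i * tX i, hX i * tX (i + 1)) \<in> F_rels d n y"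
| hth: "\<lbrakk>i \<in> {1..n - 1}; k \<in> {0..d - 1}\<rbrakk>
    \<Longrightarrow> (hX i * tX i ^ k * hX i, scalar (y k) * hX i) \<in> F_rels d n y"
| tg: "\<lbrakk>i \<in> {1..n - 1}; j \<in> {1..n}\<rbrakk>
    \<Longrightarrow> (tX j * gX i, gX i * tX (Transposition.transpose i (i + 1) j)) \<in> F_rels d n y"
| g_sq: "i \<in> {1..n - 1}
    \<Longrightarrow> (gX i ^ 2, scalar (1 - m_var) - scalar m_var * eX d i * (gX i - 1)
          + scalar (m_var * inverse l_var) * hX i) \<in> F_rels d n y"

text \<open>Only the values \<open>y 0, \<dots>, y (d - 1)\<close> matter.\<close>

definition F_alg :: "nat \<Rightarrow> nat \<Rightarrow> (nat \<Rightarrow> ground) \<Rightarrow> (ground, F_poly set) module" where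
  "F_alg d n y = presented_algebra (F_gens n) (F_rels d n y)"

lemma F_ideal:
  "ideal (Idl\<^bsub>free_algebra (F_gens n)\<^esub> {p - q |p q. (p, q) \<in> F_rels d n y})
    (free_algebra (F_gens n))"
proof -
  let ?A = "free_algebra (F_gens n) :: (ground, F_poly) module"
  have g: "gX i \<in> carrier ?A" if "i \<in> {1..n - 1}" for i
    using that by (intro free_algebra_closed) (auto simp: F_gens_def)
  have h: "hX i \<in> carrier ?A" if "i \<in> {1..n - 1}" for i
    using that by (intro free_algebra_closed) (auto simp: F_gens_def)
  have t: "tX i \<in> carrier ?A" if "i \<in> {1..n}" for i
    using that by (intro free_algebra_closed) (auto simp: F_gens_def)
  have t': "tX i \<in> carrier ?A" "tX (i + 1) \<in> carrier ?A" if "i \<in> {1..n - 1}" for i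
    using that by (auto intro!: t simp del: free_algebra_simps(1))
  have tr: "tX (Transposition.transpose i (i + 1) j) \<in> carrier ?A"
    if "i \<in> {1..n - 1}" "j \<in> {1..n}" for i j
    using that by (intro t) (auto simp: Transposition.transpose_def)
  have e: "eX d i \<in> carrier ?A" if "i \<in> {1..n - 1}" for i
    unfolding eX_def using that
    by (intro free_algebra_closed free_algebra_power_closed free_algebra_sum_closed t')
  note closed = g h t t' tr e free_algebra_closed free_algebra_power_closed
  have "p \<in> carrier ?A \<and> q \<in> carrier ?A" if "(p, q) \<in> F_rels d n y" for p q
    using that
    by (induction rule: F_rels.induct)
      (simp_all del: free_algebra_simps atLeastAtMost_iff One_nat_def add: closed)
  then have "{p - q |p q. (p, q) \<in> F_rels d n y} \<subseteq> carrier ?A"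
    using free_algebra_closed(7) by blast
  then show ?thesis
    by (rule ring.genideal_ideal[OF ring_free_algebra])
qed

lemma ring_F_alg: "ring (F_alg d n y)"
  unfolding F_alg_def presented_algebra_def by (rule ring_quotient_algebra[OF F_ideal])

lemma vectorspace_F_alg: "vectorspace class_ring (F_alg d n y)"
  unfolding F_alg_def presented_algebra_def by (rule vectorspace_quotient_algebra[OF F_ideal])

end

theory Submission
  imports Defs
begin

text \<open>
  Write \<open>A\<^sub>k\<close> for the subalgebra generated by all \<open>t\<^sub>j\<close> and by \<open>g\<^sub>1, \<dots>, g\<^sub>r\<close> with \<open>r = k - 1\<close>. As \<open>m\<close> is
  invertible, the quadratic relation expresses \<open>h\<^sub>i\<close> through \<open>g\<^sub>i\<close> and \<open>e\<^sub>i\<close> (\<open>h_poly\<close>), so \<open>A\<^sub>n\<close> is the whole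
  algebra. The algebra \<open>A\<^sub>1\<close> of the \<open>t\<^sub>j\<close> is commutative and spanned by finitely many monomials. It
  therefore suffices to show that each level adds only a finite amount, namely that the next level
  is spanned by the products \<open>p c q\<close> with \<open>p, q\<close> in \<open>A\<^sub>k\<close> and \<open>c\<close> one of \<open>1, g\<^sub>k, h\<^sub>k\<close>
  (\<open>A_Suc_subset_M\<close>).

  This span contains \<open>1\<close> and is stable under \<open>A\<^sub>k\<close> from both sides, so only right multiplication by
  \<open>g\<^sub>k\<close> has to be checked, that is, products \<open>c v g\<^sub>k\<close> with \<open>v\<close> in \<open>A\<^sub>k\<close>. By induction \<open>v\<close> is itself a sum
  of products \<open>p c' q\<close> of the same shape one level below. The factors \<open>p, q\<close> can be moved outside: \<open>g\<^sub>k\<close> and \<open>h\<^sub>k\<close>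
  commute with the distant \<open>g\<^sub>j\<close> and normalise the algebra of the \<open>t\<^sub>j\<close>. What remains are the
  products \<open>c c' g\<^sub>k\<close>, where \<open>c'\<close> is \<open>1\<close> or has index \<open>k - 1\<close> (\<open>adjacent_products_M\<close>). For \<open>c' = 1\<close> they are
  reduced by the quadratic relation and by \<open>h\<^sub>k g\<^sub>k = inverse l h\<^sub>k\<close>.

  Put \<open>a, h\<close> for the generators of index \<open>k - 1\<close> and \<open>b, f\<close> for those of index \<open>k\<close>. The braid relation
  makes \<open>a b\<close> conjugate \<open>a\<close> into \<open>b\<close>. It also shifts the indices of the \<open>t\<^sub>j\<close>, and \<open>h, f\<close> are the
  same polynomial in the respective generators, so \<open>a b h = f a b\<close>; likewise \<open>b a f = h b a\<close>.
  Moreover \<open>a\<close> has an inverse \<open>a'\<close>, given by a formula in \<open>a\<close>, \<open>h\<close> and the idempotent of index \<open>k - 1\<close>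
  (\<open>g_inv\<close>); this uses that \<open>1 - m\<close> is invertible. Together with \<open>f a f = l f\<close> this yields
  \<open>b a b = a b a\<close>, \<open>f a b = a b h\<close>, \<open>f h b = f a'\<close>, and \<open>b h b = a' f a b b\<close>, in which \<open>b b\<close> is reduced by the
  quadratic relation. In every result \<open>b\<close> or \<open>f\<close> occurs at most once in each term.

  All computations are congruences in the free algebra, modulo the preimage of the ideal of relations
  under the retraction that kills the letters outside the range of the indices.
\<close>

section \<open>Algebras modulo a two-sided ideal\<close>

text \<open>
  An identity in a quotient algebra is a congruence modulo a two-sided ideal in any algebra
  lying above it. Working with the congruence \<open>\<approx>\<close> in a ring type keeps ring arithmetic and the
  linear algebra of spans available, at the price of applying congruence rules by hand.
\<close>

locale algebra_mod_ideal = vector_space scale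
  for scale :: "'k::field \<Rightarrow> 'r::ring_1 \<Rightarrow> 'r" (infixr "*s" 75) +
  fixes I :: "'r set"
  assumes scale_mult_left: "(c *s x) * y = c *s (x * y)"
    and scale_mult_right: "x * (c *s y) = c *s (x * y)"
    and subspace_I: "subspace I"
    and ideal_left: "i \<in> I \<Longrightarrow> x * i \<in> I"
    and ideal_right: "i \<in> I \<Longrightarrow> i * x \<in> I"
begin

definition eqv :: "'r \<Rightarrow> 'r \<Rightarrow> bool" (infix "\<approx>" 50) where
  "x \<approx> y \<longleftrightarrow> x - y \<in> I"

lemma eqv_refl [simp, intro]: "x \<approx> x"
  by (simp add: eqv_def subspace_0[OF subspace_I])

lemma eqv_sym: "x \<approx> y \<Longrightarrow> y \<approx> x"
  unfolding eqv_def using subspace_neg[OF subspace_I, of "x - y"] by simp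

lemma eqv_trans [trans]: "x \<approx> y \<Longrightarrow> y \<approx> z \<Longrightarrow> x \<approx> z"
  unfolding eqv_def using subspace_add[OF subspace_I, of "x - y" "y - z"] by simp

lemma eqv_eq_trans [trans]: "x \<approx> y \<Longrightarrow> y = z \<Longrightarrow> x \<approx> z"
  and eq_eqv_trans [trans]: "x = y \<Longrightarrow> y \<approx> z \<Longrightarrow> x \<approx> z"
  by simp_all

lemma eqv_add: "x \<approx> x' \<Longrightarrow> y \<approx> y' \<Longrightarrow> x + y \<approx> x' + y'"
  unfolding eqv_def
  using subspace_add[OF subspace_I, of "x - x'" "y - y'"] by (simp add: algebra_simps)

lemma eqv_diff: "x \<approx> x' \<Longrightarrow> y \<approx> y' \<Longrightarrow> x - y \<approx> x' - y'"
  unfolding eqv_def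
  using subspace_diff[OF subspace_I, of "x - x'" "y - y'"] by (simp add: algebra_simps)

lemma eqv_scale: "x \<approx> x' \<Longrightarrow> c *s x \<approx> c *s x'"
  unfolding eqv_def
  using subspace_scale[OF subspace_I, of "x - x'" c] by (simp add: scale_right_diff_distrib)

lemma eqv_mult: "x \<approx> x' \<Longrightarrow> y \<approx> y' \<Longrightarrow> x * y \<approx> x' * y'"
  unfolding eqv_def
  using subspace_add[OF subspace_I ideal_right[of "x - x'" y] ideal_left[of "y - y'" x']]
  by (simp add: algebra_simps)

lemma eqv_power: "x \<approx> x' \<Longrightarrow> x ^ k \<approx> x' ^ k"
  by (induction k) (auto intro: eqv_mult)

lemma eqv_sum: "(\<And>a. a \<in> A \<Longrightarrow> f a \<approx> f' a) \<Longrightarrow> sum f A \<approx> sum f' A"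
  by (induction A rule: infinite_finite_induct) (auto intro: eqv_add)

lemma eqv_left: "x \<approx> y \<Longrightarrow> x * v \<approx> y * v"
  and eqv_right: "x \<approx> y \<Longrightarrow> u * x \<approx> u * y"
  and eqv_middle: "x \<approx> y \<Longrightarrow> u * x * v \<approx> u * y * v"
  by (intro eqv_mult eqv_refl; assumption)+

lemmas eqv_cong = eqv_refl eqv_add eqv_diff eqv_scale eqv_mult

lemma eqv_0_iff: "x \<approx> 0 \<longleftrightarrow> x \<in> I"
  by (simp add: eqv_def)

lemma subspace_eqv_closed:
  assumes "subspace M" "I \<subseteq> M" "y \<in> M" "x \<approx> y"
  shows "x \<in> M"
  using subspace_add[OF assms(1,3), of "x - y"] assms(2,4) by (auto simp: eqv_def)

subsection \<open>Intertwining elements\<close>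

text \<open>
  \<open>u\<close> intertwines \<open>x\<close> with \<open>x'\<close> if \<open>x'\<close> behaves as the conjugate of \<open>x\<close> by \<open>u\<close>. For fixed \<open>u\<close> the pairs \<open>(x, x')\<close> form a subalgebra of the product algebra, so
  conjugation rules pass from generators to every polynomial in them.
\<close>

definition intertwines :: "'r \<Rightarrow> 'r \<Rightarrow> 'r \<Rightarrow> bool" where
  "intertwines u x x' \<longleftrightarrow> u * x \<approx> x' * u"

lemma intertwines_one: "intertwines u 1 1"
  by (simp add: intertwines_def)

lemma intertwines_add:
  "intertwines u x x' \<Longrightarrow> intertwines u y y' \<Longrightarrow> intertwines u (x + y) (x' + y')"
  by (simp add: intertwines_def distrib_left distrib_right eqv_add)

lemma intertwines_diff:
  "intertwines u x x' \<Longrightarrow> intertwines u y y' \<Longrightarrow> intertwines u (x - y) (x' - y')"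
  by (simp add: intertwines_def left_diff_distrib right_diff_distrib eqv_diff)

lemma intertwines_scale: "intertwines u x x' \<Longrightarrow> intertwines u (c *s x) (c *s x')"
  by (simp add: intertwines_def scale_mult_left scale_mult_right eqv_scale)

lemma intertwines_mult:
  assumes "intertwines u x x'" "intertwines u y y'"
  shows "intertwines u (x * y) (x' * y')"
proof -
  have "(u * x) * y \<approx> (x' * u) * y"
    using assms(1) by (auto simp: intertwines_def intro: eqv_mult)
  also have "\<dots> = x' * (u * y)"
    by (simp add: mult.assoc)
  also have "\<dots> \<approx> x' * (y' * u)"
    using assms(2) by (auto simp: intertwines_def intro: eqv_mult)
  finally show ?thesis
    by (simp add: intertwines_def mult.assoc)
qed

lemma intertwines_power: "intertwines u x x' \<Longrightarrow> intertwines u (x ^ k) (x' ^ k)"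
  by (induction k) (auto intro: intertwines_one intertwines_mult)

lemma intertwines_sum:
  "(\<And>a. a \<in> A \<Longrightarrow> intertwines u (f a) (f' a)) \<Longrightarrow> intertwines u (sum f A) (sum f' A)"
proof (induction A rule: infinite_finite_induct)
qed (auto simp: intertwines_def[of u 0] intro: intertwines_add)

lemma intertwines_eqv:
  assumes "intertwines u x x'" "y \<approx> x" "y' \<approx> x'"
  shows "intertwines u y y'"
proof -
  have "u * y \<approx> u * x" using assms by (intro eqv_cong)
  also have "\<dots> \<approx> x' * u" using assms(1) by (simp add: intertwines_def)
  also have "\<dots> \<approx> y' * u" using eqv_sym[OF assms(3)] by (intro eqv_cong)
  finally show ?thesis by (simp add: intertwines_def)
qed

lemma intertwines_compose:
  assumes "intertwines v x x'" "intertwines u x' x''"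
  shows "intertwines (u * v) x x''"
proof -
  have "u * (v * x) \<approx> u * (x' * v)"
    using assms(1) by (auto simp: intertwines_def intro: eqv_mult)
  also have "\<dots> = (u * x') * v"
    by (simp add: mult.assoc)
  also have "\<dots> \<approx> (x'' * u) * v"
    using assms(2) by (auto simp: intertwines_def intro: eqv_mult)
  finally show ?thesis
    by (simp add: intertwines_def mult.assoc)
qed

lemma commute_sym: "intertwines x y y \<Longrightarrow> intertwines y x x"
  by (simp add: intertwines_def eqv_sym)

subsection \<open>Generated subalgebras\<close>

text \<open>
  The subalgebra generated by \<open>S\<close>, saturated with respect to \<open>\<approx>\<close>. Products grow by one generator
  on the right only: to bound the subalgebra by a subspace it then suffices to check right
  multiplication by the generators.
\<close>

inductive_set generated :: "'r set \<Rightarrow> 'r set" for S where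
  ideal: "i \<in> I \<Longrightarrow> i \<in> generated S"
| one: "1 \<in> generated S"
| add: "x \<in> generated S \<Longrightarrow> y \<in> generated S \<Longrightarrow> x + y \<in> generated S"
| scale: "x \<in> generated S \<Longrightarrow> c *s x \<in> generated S"
| mult_gen: "x \<in> generated S \<Longrightarrow> s \<in> S \<Longrightarrow> x * s \<in> generated S"

lemma generated_gen: "s \<in> S \<Longrightarrow> s \<in> generated S"
  using generated.mult_gen[OF generated.one] by force

lemma subspace_generated: "subspace (generated S)"
  by (auto simp: subspace_def intro: generated.intros subspace_0[OF subspace_I])

lemma generated_mult: "y \<in> generated S \<Longrightarrow> x \<in> generated S \<Longrightarrow> x * y \<in> generated S"
proof (induction y rule: generated.induct)
  case (mult_gen y s)
  then show ?case using generated.mult_gen[of "x * y" S s] by (simp add: mult.assoc)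
qed (auto intro: generated.intros ideal_left simp: distrib_left scale_mult_right)

lemma generated_power: "x \<in> generated S \<Longrightarrow> x ^ k \<in> generated S"
  by (induction k) (auto intro: generated.one generated_mult)

lemma generated_diff: "x \<in> generated S \<Longrightarrow> y \<in> generated S \<Longrightarrow> x - y \<in> generated S"
  by (rule subspace_diff[OF subspace_generated])

lemma generated_sum: "(\<And>a. a \<in> A \<Longrightarrow> f a \<in> generated S) \<Longrightarrow> sum f A \<in> generated S"
  by (rule subspace_sum[OF subspace_generated])

lemma generated_eqv: "y \<in> generated S \<Longrightarrow> x \<approx> y \<Longrightarrow> x \<in> generated S"
  by (rule subspace_eqv_closed[OF subspace_generated]) (auto intro: generated.ideal)

lemmas generated_closed =
  generated.one generated.add generated.scale generated_mult generated_power
  generated_diff generated_sum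

lemma generated_mono: "S \<subseteq> S' \<Longrightarrow> generated S \<subseteq> generated S'"
proof
  fix x assume "x \<in> generated S" "S \<subseteq> S'"
  then show "x \<in> generated S'"
    by (induction rule: generated.induct) (auto intro: generated.intros)
qed

lemma generated_subset:
  assumes "subspace M" "I \<subseteq> M" "1 \<in> M" "\<And>x s. x \<in> M \<Longrightarrow> s \<in> S \<Longrightarrow> x * s \<in> M"
  shows "generated S \<subseteq> M"
proof
  fix x assume "x \<in> generated S"
  then show "x \<in> M"
    by (induction rule: generated.induct)
      (use assms in \<open>auto intro: subspace_add subspace_scale\<close>)
qed

text \<open>
  If \<open>u\<close> can be moved past every generator at the cost of changing it within the subalgebra, then it
  can be moved past the whole subalgebra.
\<close>

lemma push_left:
  assumes "\<And>s. s \<in> S \<Longrightarrow> \<exists>s'\<in>generated S. u * s \<approx> s' * u" and "x \<in> generated S"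
  shows "\<exists>x'\<in>generated S. u * x \<approx> x' * u"
  using assms(2)
proof (induction rule: generated.induct)
  case (ideal i)
  then show ?case
    using subspace_0[OF subspace_generated]
    by (intro bexI[of _ 0]) (auto simp: eqv_0_iff ideal_left)
next
  case one
  then show ?case by (intro bexI[of _ 1]) (auto intro: generated.one)
next
  case (add x y)
  then obtain x' y' where "x' \<in> generated S" "u * x \<approx> x' * u" "y' \<in> generated S" "u * y \<approx> y' * u"
    by blast
  then show ?case
    by (intro bexI[of _ "x' + y'"]) (auto intro: generated.add eqv_add simp: distrib_left distrib_right)
next
  case (scale x c)
  then obtain x' where "x' \<in> generated S" "u * x \<approx> x' * u" by blast
  then show ?case
    by (intro bexI[of _ "c *s x'"])
      (auto intro: generated.scale eqv_scale simp: scale_mult_left scale_mult_right)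
next
  case (mult_gen x s)
  then obtain x' s' where *: "x' \<in> generated S" "u * x \<approx> x' * u" "s' \<in> generated S" "u * s \<approx> s' * u"
    using assms(1) by blast
  then have "intertwines u (x * s) (x' * s')"
    by (intro intertwines_mult) (auto simp: intertwines_def)
  with * show ?case
    by (intro bexI[of _ "x' * s'"]) (auto intro: generated_mult simp: intertwines_def)
qed

lemma push_right:
  assumes "\<And>s. s \<in> S \<Longrightarrow> \<exists>s'\<in>generated S. s * u \<approx> u * s'" and "x \<in> generated S"
  shows "\<exists>x'\<in>generated S. x * u \<approx> u * x'"
  using assms(2)
proof (induction rule: generated.induct)
  case (ideal i)
  then show ?case
    using subspace_0[OF subspace_generated]
    by (intro bexI[of _ 0]) (auto simp: eqv_0_iff ideal_right)
next
  case one
  then show ?case by (intro bexI[of _ 1]) (auto intro: generated.one)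
next
  case (add x y)
  then obtain x' y' where "x' \<in> generated S" "x * u \<approx> u * x'" "y' \<in> generated S" "y * u \<approx> u * y'"
    by blast
  then show ?case
    by (intro bexI[of _ "x' + y'"]) (auto intro: generated.add eqv_add simp: distrib_left distrib_right)
next
  case (scale x c)
  then obtain x' where "x' \<in> generated S" "x * u \<approx> u * x'" by blast
  then show ?case
    by (intro bexI[of _ "c *s x'"])
      (auto intro: generated.scale eqv_scale simp: scale_mult_left scale_mult_right)
next
  case (mult_gen x s)
  then obtain x' s' where *: "x' \<in> generated S" "x * u \<approx> u * x'" "s' \<in> generated S" "s * u \<approx> u * s'"
    using assms(1) by blast
  have "x * s * u \<approx> x * (u * s')" using * by (auto simp: mult.assoc intro: eqv_mult)
  also have "\<dots> = (x * u) * s'" by (simp add: mult.assoc)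
  also have "\<dots> \<approx> (u * x') * s'" using * by (auto intro: eqv_mult)
  finally show ?case
    using * by (intro bexI[of _ "x' * s'"]) (auto intro: generated_mult simp: mult.assoc)
qed

subsection \<open>Finite dimension modulo the ideal\<close>

text \<open>
  Finite-dimensional span of the image of \<open>U\<close> in the quotient by \<open>I\<close>.
\<close>

definition finite_mod :: "'r set \<Rightarrow> bool" where
  "finite_mod U \<longleftrightarrow> (\<exists>F. finite F \<and> U \<subseteq> span (F \<union> I))"

lemma finite_mod_subset: "finite_mod V \<Longrightarrow> U \<subseteq> V \<Longrightarrow> finite_mod U"
  unfolding finite_mod_def by blast

definition products :: "'r set \<Rightarrow> 'r set \<Rightarrow> 'r set \<Rightarrow> 'r set" where
  "products U C V = span {u * c * v |u c v. u \<in> U \<and> c \<in> C \<and> v \<in> V}"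

lemma products_mem: "u \<in> U \<Longrightarrow> c \<in> C \<Longrightarrow> v \<in> V \<Longrightarrow> u * c * v \<in> products U C V"
  unfolding products_def by (intro span_base) blast

lemma subspace_products: "subspace (products U C V)"
  by (simp add: products_def)

lemma products_induct:
  assumes "x \<in> products U C V" "subspace {x. P x}"
    and "\<And>u c v. u \<in> U \<Longrightarrow> c \<in> C \<Longrightarrow> v \<in> V \<Longrightarrow> P (u * c * v)"
  shows "P x"
  using assms(1) unfolding products_def
  by (rule span_induct) (use assms(2,3) in auto)

lemma subspace_two_sided_preimage:
  assumes "subspace M"
  shows "subspace {x. a * x * b \<in> M}"
  using assms
  by (auto simp: subspace_def distrib_left distrib_right scale_mult_left scale_mult_right)

text \<open>
  The span of \<open>U C V\<close> is the image of a multilinear map, so products of spanning vectors span it;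
  products with a factor in \<open>I\<close> stay in \<open>I\<close>.
\<close>

lemma finite_mod_products:
  assumes "finite_mod U" "finite C" "finite_mod V"
  shows "finite_mod (products U C V)"
proof -
  obtain F G where F: "finite F" "U \<subseteq> span (F \<union> I)" and G: "finite G" "V \<subseteq> span (G \<union> I)"
    using assms unfolding finite_mod_def by blast
  let ?K = "(\<lambda>(f, c, g). f * c * g) ` (F \<times> C \<times> G)"
  let ?W = "span (?K \<union> I)"
  have I: "i \<in> ?W" if "i \<in> I" for i using that by (intro span_base) simp
  have 1: "f * c * v \<in> ?W" if "f \<in> F \<union> I" "c \<in> C" "v \<in> span (G \<union> I)" for f c v
    using that(3)
  proof (rule span_induct)
    show "subspace {v. f * c * v \<in> ?W}"
      using subspace_two_sided_preimage[of ?W "f * c" 1] by simp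
    fix v assume v: "v \<in> G \<union> I"
    show "f * c * v \<in> ?W"
    proof (cases "f \<in> I \<or> v \<in> I")
      case True
      then show ?thesis by (intro I) (auto intro: ideal_left ideal_right)
    next
      case False
      then have "f * c * v \<in> ?K" using that v by force
      then show ?thesis by (intro span_base) simp
    qed
  qed
  have 2: "u * c * v \<in> ?W" if "u \<in> span (F \<union> I)" "c \<in> C" "v \<in> span (G \<union> I)" for u c v
    using that(1)
  proof (rule span_induct)
    show "subspace {u. u * c * v \<in> ?W}"
      using subspace_two_sided_preimage[of ?W 1 "c * v"] by (simp add: mult.assoc)
  qed (use 1 that in auto)
  have "products U C V \<subseteq> ?W"
    unfolding products_def using 2 F(2) G(2) by (intro span_minimal subsetI) (blast, simp)
  moreover have "finite ?K" using F G assms(2) by simp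
  ultimately show ?thesis unfolding finite_mod_def by blast
qed

end

section \<open>Averaging idempotents\<close>

text \<open>
  With \<open>j = i + 1\<close>, the element \<open>e\<^sub>i\<close> of the relations is the average of the powers of \<open>t\<^sub>i t'\<close>, where \<open>t'\<close> is the inverse of
  \<open>t\<^sub>j\<close>, and is therefore the idempotent projecting onto the vectors on which \<open>t\<^sub>i\<close> and \<open>t\<^sub>j\<close> agree. Every
  property of it used below follows from this description.
\<close>

context algebra_mod_ideal
begin

definition avg :: "nat \<Rightarrow> 'r \<Rightarrow> 'r \<Rightarrow> 'r" where
  "avg d a b = (1 / of_nat d) *s (\<Sum>s = 0..d - 1. a ^ s * (b ^ (d - 1)) ^ s)"

lemma intertwines_avg:
  "intertwines u a a' \<Longrightarrow> intertwines u b b' \<Longrightarrow> intertwines u (avg d a b) (avg d a' b')"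
  unfolding avg_def
  by (intro intertwines_scale intertwines_sum intertwines_mult intertwines_power)

lemma generated_avg: "a \<in> generated S \<Longrightarrow> b \<in> generated S \<Longrightarrow> avg d a b \<in> generated S"
  unfolding avg_def by (intro generated_closed)

lemma scale_sum_const:
  assumes "d > 0" "of_nat d \<noteq> (0 :: 'k)"
  shows "(1 / of_nat d) *s (\<Sum>s = 0..d - 1. x) = x"
proof -
  have "(\<Sum>s = 0..d - 1. x) = (\<Sum>s = 0..d - 1. 1 *s x)"
    by simp
  also have "\<dots> = of_nat d *s x"
    using assms(1) by (simp only: scale_sum_left[symmetric]) simp
  finally show ?thesis
    using assms(2) by simp
qed

end

locale commuting_torsion_pair = algebra_mod_ideal scale I
  for scale :: "'k::field \<Rightarrow> 'r::ring_1 \<Rightarrow> 'r" (infixr "*s" 75) and I +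
  fixes d :: nat and a b :: 'r
  assumes d_pos: "d > 0" and d_nz: "of_nat d \<noteq> (0 :: 'k)"
    and a_torsion: "a ^ d \<approx> 1" and b_torsion: "b ^ d \<approx> 1"
    and commute: "a * b \<approx> b * a"
begin

lemma swap: "commuting_torsion_pair scale I d b a"
  using d_pos d_nz a_torsion b_torsion eqv_sym[OF commute] by unfold_locales

lemma intertwines_ab: "intertwines a b b" and intertwines_ba: "intertwines b a a"
  using commute eqv_sym[OF commute] by (auto simp: intertwines_def)

lemma a_commutes_power: "a * b ^ s \<approx> b ^ s * a"
  using intertwines_power[OF intertwines_ab, of s] by (simp add: intertwines_def)

lemma power_inverse_power: "b ^ s * (b ^ (d - 1)) ^ s \<approx> 1" "(b ^ (d - 1)) ^ s * b ^ s \<approx> 1"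
proof -
  have "s + (d - 1) * s = d * s" "(d - 1) * s + s = d * s"
    using d_pos by (cases d; simp)+
  then have "b ^ s * (b ^ (d - 1)) ^ s = (b ^ d) ^ s" "(b ^ (d - 1)) ^ s * b ^ s = (b ^ d) ^ s"
    by (simp_all only: power_mult[symmetric] power_add[symmetric])
  then show "b ^ s * (b ^ (d - 1)) ^ s \<approx> 1" "(b ^ (d - 1)) ^ s * b ^ s \<approx> 1"
    using eqv_power[OF b_torsion, of s] by simp_all
qed

text \<open>
  Each summand of the average acts trivially on a vector on which \<open>a\<close> and \<open>b\<close> agree.
\<close>

lemma avg_absorb_right:
  assumes "x * a \<approx> x * b"
  shows "x * avg d a b \<approx> x"
proof -
  have pow: "x * a ^ s \<approx> x * b ^ s" for s
  proof (induction s)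
    case (Suc s)
    have "x * a ^ Suc s = (x * a ^ s) * a" by (simp add: power_Suc2 mult.assoc del: power_Suc)
    also have "\<dots> \<approx> (x * b ^ s) * a" by (intro eqv_cong Suc)
    also have "\<dots> = x * (b ^ s * a)" by (simp add: mult.assoc)
    also have "\<dots> \<approx> x * (a * b ^ s)"
      by (intro eqv_cong eqv_sym[OF a_commutes_power])
    also have "\<dots> = (x * a) * b ^ s" by (simp add: mult.assoc)
    also have "\<dots> \<approx> (x * b) * b ^ s" by (intro eqv_cong assms)
    finally show ?case by (simp add: mult.assoc)
  qed auto
  have "x * (a ^ s * (b ^ (d - 1)) ^ s) \<approx> x" for s
  proof -
    have "x * (a ^ s * (b ^ (d - 1)) ^ s) = x * a ^ s * (b ^ (d - 1)) ^ s" by (simp add: mult.assoc)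
    also have "\<dots> \<approx> x * b ^ s * (b ^ (d - 1)) ^ s" by (intro eqv_cong pow)
    also have "\<dots> = x * (b ^ s * (b ^ (d - 1)) ^ s)" by (simp add: mult.assoc)
    also have "\<dots> \<approx> x * 1" by (intro eqv_cong power_inverse_power)
    finally show ?thesis by simp
  qed
  then have "(1 / of_nat d) *s (\<Sum>s = 0..d - 1. x * (a ^ s * (b ^ (d - 1)) ^ s))
      \<approx> (1 / of_nat d) *s (\<Sum>s = 0..d - 1. x)"
    by (intro eqv_scale eqv_sum)
  then show ?thesis
    by (simp only: avg_def scale_mult_right sum_distrib_left scale_sum_const[OF d_pos d_nz])
qed

lemma avg_absorb_left:
  assumes "a * x \<approx> b * x"
  shows "avg d a b * x \<approx> x"
proof -
  have pow: "a ^ s * x \<approx> b ^ s * x" for s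
  proof (induction s)
    case (Suc s)
    have "a ^ Suc s * x = a * (a ^ s * x)" by (simp add: mult.assoc)
    also have "\<dots> \<approx> a * (b ^ s * x)" by (intro eqv_cong Suc)
    also have "\<dots> = (a * b ^ s) * x" by (simp add: mult.assoc)
    also have "\<dots> \<approx> (b ^ s * a) * x"
      by (intro eqv_cong a_commutes_power)
    also have "\<dots> = b ^ s * (a * x)" by (simp add: mult.assoc)
    also have "\<dots> \<approx> b ^ s * (b * x)" by (intro eqv_cong assms)
    finally show ?case by (simp only: power_Suc2 mult.assoc)
  qed auto
  have "(a ^ s * (b ^ (d - 1)) ^ s) * x \<approx> x" for s
  proof -
    have "(a ^ s * (b ^ (d - 1)) ^ s) * x \<approx> ((b ^ (d - 1)) ^ s * a ^ s) * x"
    proof (rule eqv_mult[OF _ eqv_refl])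
      have "intertwines a ((b ^ (d - 1)) ^ s) ((b ^ (d - 1)) ^ s)"
        by (intro intertwines_power intertwines_ab)
      from intertwines_power[OF commute_sym[OF this], of s]
      show "a ^ s * (b ^ (d - 1)) ^ s \<approx> (b ^ (d - 1)) ^ s * a ^ s"
        by (auto simp: intertwines_def intro: eqv_sym)
    qed
    also have "\<dots> = (b ^ (d - 1)) ^ s * (a ^ s * x)" by (simp add: mult.assoc)
    also have "\<dots> \<approx> (b ^ (d - 1)) ^ s * (b ^ s * x)" by (intro eqv_cong pow)
    also have "\<dots> = ((b ^ (d - 1)) ^ s * b ^ s) * x" by (simp add: mult.assoc)
    also have "\<dots> \<approx> 1 * x" by (intro eqv_cong power_inverse_power)
    finally show ?thesis by simp
  qed
  then have "(1 / of_nat d) *s (\<Sum>s = 0..d - 1. (a ^ s * (b ^ (d - 1)) ^ s) * x)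
      \<approx> (1 / of_nat d) *s (\<Sum>s = 0..d - 1. x)"
    by (intro eqv_scale eqv_sum)
  then show ?thesis
    by (simp only: avg_def scale_mult_left sum_distrib_right scale_sum_const[OF d_pos d_nz])
qed

text \<open>
  Multiplication by \<open>a c\<close>, where \<open>c\<close> is the inverse of \<open>b\<close>, permutes the summands cyclically because
  \<open>(a c)\<^sup>d = 1\<close>.
\<close>

lemma avg_shift: "avg d a b * a \<approx> avg d a b * b"
proof -
  define c where "c = b ^ (d - 1)"
  define f where "f s = a ^ s * c ^ s" for s
  have comm: "intertwines (c ^ s) a a" for s
    unfolding c_def by (rule commute_sym) (intro intertwines_power intertwines_ab)
  have step: "f s * (a * c) \<approx> f (Suc s)" for s
  proof -
    have "f s * (a * c) = a ^ s * (c ^ s * a) * c" by (simp add: f_def mult.assoc)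
    also have "\<dots> \<approx> a ^ s * (a * c ^ s) * c"
      using comm[of s] unfolding intertwines_def by (rule eqv_middle)
    finally show ?thesis by (simp only: f_def power_Suc2 mult.assoc)
  qed
  have "f d = a ^ d * (b ^ d) ^ (d - 1)"
    by (simp add: f_def c_def power_mult[symmetric] mult.commute)
  also have "\<dots> \<approx> 1 * (b ^ d) ^ (d - 1)"
    by (intro eqv_cong a_torsion)
  also have "\<dots> \<approx> 1 * 1 ^ (d - 1)"
    by (intro eqv_cong eqv_power b_torsion)
  finally have fd: "f d \<approx> f 0" by (simp add: f_def)
  have "(\<Sum>s = 0..d - 1. f s) * (a * c) = (\<Sum>s = 0..d - 1. f s * (a * c))"
    by (simp add: sum_distrib_right)
  also have "\<dots> \<approx> (\<Sum>s = 0..d - 1. f (Suc s))"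
    by (intro eqv_sum step)
  also have "\<dots> = (\<Sum>s = 1..d. f s)"
    using sum.shift_bounds_cl_Suc_ivl[of f 0 "d - 1"] d_pos by simp
  also have "\<dots> = (\<Sum>s = 1..d - 1. f s) + f d"
    using d_pos by (cases d) simp_all
  also have "\<dots> \<approx> (\<Sum>s = 1..d - 1. f s) + f 0"
    by (intro eqv_cong fd)
  also have "\<dots> = (\<Sum>s = 0..d - 1. f s)"
    using sum.atLeast_Suc_atMost[of 0 "d - 1" f] by (simp add: add.commute)
  finally have *: "avg d a b * (a * c) \<approx> avg d a b"
    unfolding avg_def c_def[symmetric] f_def scale_mult_left by (rule eqv_scale)
  have "avg d a b * b \<approx> (avg d a b * (a * c)) * b"
    by (intro eqv_cong eqv_sym[OF *])
  also have "\<dots> = avg d a b * a * (c * b)" by (simp add: mult.assoc)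
  also have "\<dots> \<approx> avg d a b * a * 1"
    using power_inverse_power(2)[of 1] by (intro eqv_cong) (simp add: c_def)
  finally show ?thesis by (simp add: eqv_sym)
qed

lemma avg_idem: "avg d a b * avg d a b \<approx> avg d a b"
  by (rule avg_absorb_right[OF avg_shift])

lemma intertwines_a_avg: "intertwines a (avg d a b) (avg d a b)"
  and intertwines_b_avg: "intertwines b (avg d a b) (avg d a b)"
proof -
  have "intertwines x x x" for x by (simp add: intertwines_def)
  then show "intertwines a (avg d a b) (avg d a b)" "intertwines b (avg d a b) (avg d a b)"
    using intertwines_avg intertwines_ab intertwines_ba by blast+
qed

lemma avg_shift_left: "a * avg d a b \<approx> b * avg d a b"
proof -
  have "a * avg d a b \<approx> avg d a b * a" using intertwines_a_avg by (simp add: intertwines_def)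
  also have "\<dots> \<approx> avg d a b * b" by (rule avg_shift)
  also have "\<dots> \<approx> b * avg d a b"
    using intertwines_b_avg by (simp add: intertwines_def eqv_sym)
  finally show ?thesis .
qed

text \<open>
  Both averages project onto the same vectors, so each absorbs the other.
\<close>

lemma avg_commute: "avg d a b \<approx> avg d b a"
proof -
  interpret ba: commuting_torsion_pair scale I d b a by (rule swap)
  have "avg d a b \<approx> avg d a b * avg d b a"
    by (rule eqv_sym[OF ba.avg_absorb_right[OF eqv_sym[OF avg_shift]]])
  also have "\<dots> \<approx> avg d b a"
    by (rule avg_absorb_left[OF eqv_sym[OF ba.avg_shift_left]])
  finally show ?thesis .
qed

end

section \<open>Consequences of the relations\<close>

text \<open>
  Read \<open>\<approx>\<close> as equality in the quotient by \<open>I\<close>: the images of \<open>g\<close>, \<open>h\<close>, \<open>t\<close> there satisfy relations of the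
  framized BMW algebra.
\<close>

locale framized_BMW = algebra_mod_ideal scale I
  for scale :: "'k::field \<Rightarrow> 'r::ring_1 \<Rightarrow> 'r" (infixr "*s" 75) and I +
  fixes l m :: 'k and d n :: nat and g h t :: "nat \<Rightarrow> 'r"
  assumes l_nz: "l \<noteq> 0" and m_nz: "m \<noteq> 0" and m_neq_1: "m \<noteq> 1"
    and d_pos: "d > 0" and d_nz: "of_nat d \<noteq> (0 :: 'k)"
    and braid: "1 \<le> i \<Longrightarrow> i + 1 < n \<Longrightarrow> g i * g (i + 1) * g i \<approx> g (i + 1) * g i * g (i + 1)"
    and far: "1 \<le> i \<Longrightarrow> i + 1 < j \<Longrightarrow> j < n \<Longrightarrow> g i * g j \<approx> g j * g i"
    and gh: "1 \<le> i \<Longrightarrow> i < n \<Longrightarrow> g i * h i \<approx> inverse l *s h i"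
    and hgh: "1 \<le> i \<Longrightarrow> i + 1 < n \<Longrightarrow> h (i + 1) * g i * h (i + 1) \<approx> l *s h (i + 1)"
    and t_pow: "j \<in> {1..n} \<Longrightarrow> t j ^ d \<approx> 1"
    and t_comm: "i \<in> {1..n} \<Longrightarrow> j \<in> {1..n} \<Longrightarrow> t i * t j \<approx> t j * t i"
    and th: "1 \<le> i \<Longrightarrow> i < n \<Longrightarrow> t i * h i \<approx> t (i + 1) * h i"
    and tg: "1 \<le> i \<Longrightarrow> i < n \<Longrightarrow> j \<in> {1..n} \<Longrightarrow>
      t j * g i \<approx> g i * t (Transposition.transpose i (i + 1) j)"
    and g_sq: "1 \<le> i \<Longrightarrow> i < n \<Longrightarrow> g i * g i \<approx>
      (1 - m) *s 1 - m *s (avg d (t i) (t (i + 1)) * (g i - 1)) + (m * inverse l) *s h i"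
begin

definition e :: "nat \<Rightarrow> 'r" where
  "e i = avg d (t i) (t (i + 1))"

lemma t_pair:
  assumes "1 \<le> i" "i < n"
  shows "commuting_torsion_pair scale I d (t i) (t (i + 1))"
proof
  show "t i ^ d \<approx> 1" "t (i + 1) ^ d \<approx> 1" using assms by (intro t_pow; simp)+
  show "t i * t (i + 1) \<approx> t (i + 1) * t i" using assms by (intro t_comm) auto
qed (fact d_pos d_nz)+

lemma e_shift: "1 \<le> i \<Longrightarrow> i < n \<Longrightarrow> e i * t i \<approx> e i * t (i + 1)"
  and t_e: "1 \<le> i \<Longrightarrow> i < n \<Longrightarrow> intertwines (t i) (e i) (e i)"
  and t_Suc_e: "1 \<le> i \<Longrightarrow> i < n \<Longrightarrow> intertwines (t (i + 1)) (e i) (e i)"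
  and e_idem: "1 \<le> i \<Longrightarrow> i < n \<Longrightarrow> e i * e i \<approx> e i"
  unfolding e_def
  by (fact commuting_torsion_pair.avg_shift[OF t_pair]
      commuting_torsion_pair.intertwines_a_avg[OF t_pair]
      commuting_torsion_pair.intertwines_b_avg[OF t_pair]
      commuting_torsion_pair.avg_idem[OF t_pair])+

lemma e_h: "1 \<le> i \<Longrightarrow> i < n \<Longrightarrow> e i * h i \<approx> h i"
  unfolding e_def by (rule commuting_torsion_pair.avg_absorb_left[OF t_pair th])

lemma g_t:
  assumes "1 \<le> i" "i < n"
  shows "intertwines (g i) (t (i + 1)) (t i)" "intertwines (g i) (t i) (t (i + 1))"
    and "\<And>j. j \<in> {1..n} \<Longrightarrow> j \<noteq> i \<Longrightarrow> j \<noteq> i + 1 \<Longrightarrow> intertwines (g i) (t j) (t j)"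
proof -
  have t: "intertwines (g i) (t (Transposition.transpose i (i + 1) j)) (t j)" if "j \<in> {1..n}" for j
    using eqv_sym[OF tg[OF assms that]] by (simp add: intertwines_def)
  show "intertwines (g i) (t (i + 1)) (t i)" "intertwines (g i) (t i) (t (i + 1))"
    using t[of i] t[of "i + 1"] assms by auto
  show "intertwines (g i) (t j) (t j)" if "j \<in> {1..n}" "j \<noteq> i" "j \<noteq> i + 1" for j
    using t[OF that(1)] that(2,3) by simp
qed

text \<open>
  Conjugation by \<open>g\<^sub>i\<close> exchanges the two arguments of the average, which is symmetric in them.
\<close>

lemma g_e:
  assumes "1 \<le> i" "i < n"
  shows "intertwines (g i) (e i) (e i)"
proof (rule intertwines_eqv)
  show "intertwines (g i) (avg d (t i) (t (i + 1))) (avg d (t (i + 1)) (t i))"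
    by (intro intertwines_avg g_t assms)
  show "e i \<approx> avg d (t (i + 1)) (t i)"
    unfolding e_def by (rule commuting_torsion_pair.avg_commute[OF t_pair[OF assms]])
qed (simp add: e_def)

text \<open>
  Since \<open>m\<close> is invertible, the quadratic relation can be solved for \<open>h\<^sub>i\<close>. Hence \<open>h\<^sub>i\<close> lies in every
  subalgebra containing \<open>g\<^sub>i\<close>, \<open>t\<^sub>i\<close> and its successor, and satisfies the same conjugation rules as these.
\<close>

lemma h_poly:
  assumes "1 \<le> i" "i < n"
  shows "h i \<approx> (l * inverse m) *s (g i * g i - (1 - m) *s 1 + m *s (e i * g i) - m *s e i)"
proof (rule eqv_sym)
  let ?q = "(1 - m) *s 1 - m *s (e i * (g i - 1))"
  have "(l * inverse m) *s (g i * g i - ?q) \<approx>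
      (l * inverse m) *s ((?q + (m * inverse l) *s h i) - ?q)"
    using g_sq[OF assms] unfolding e_def by (intro eqv_scale eqv_diff eqv_refl)
  also have "\<dots> = h i" using l_nz m_nz by (simp add: field_simps)
  also have "g i * g i - ?q = g i * g i - (1 - m) *s 1 + m *s (e i * g i) - m *s e i"
    by (simp add: algebra_simps scale_right_diff_distrib)
  finally show "(l * inverse m) *s (g i * g i - (1 - m) *s 1 + m *s (e i * g i) - m *s e i) \<approx> h i" .
qed

lemma intertwines_h:
  assumes "1 \<le> i" "i < n" "1 \<le> j" "j < n"
    and "intertwines u (g i * g i) (g j * g j)" "intertwines u (e i * g i) (e j * g j)"
    and "intertwines u (e i) (e j)"
  shows "intertwines u (h i) (h j)"
  by (rule intertwines_eqv[OF _ h_poly h_poly])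
    (intro intertwines_scale intertwines_add intertwines_diff intertwines_one assms)+

lemma intertwines_h':
  assumes "1 \<le> i" "i < n" "1 \<le> j" "j < n"
    and "intertwines u (g i) (g j)" "intertwines u (t i) (t j)"
    and "intertwines u (t (i + 1)) (t (j + 1))"
  shows "intertwines u (h i) (h j)"
proof -
  have "intertwines u (e i) (e j)" unfolding e_def by (intro intertwines_avg assms)
  then show ?thesis by (intro intertwines_h intertwines_mult assms)
qed

lemma hg:
  assumes "1 \<le> i" "i < n"
  shows "h i * g i \<approx> inverse l *s h i"
proof -
  have "intertwines (g i) (g i) (g i)" by (simp add: intertwines_def)
  then have "intertwines (g i) (h i) (h i)"
    by (intro intertwines_h intertwines_mult g_e assms)
  then have "h i * g i \<approx> g i * h i" by (simp add: intertwines_def eqv_sym)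
  also have "\<dots> \<approx> inverse l *s h i" by (rule gh[OF assms])
  finally show ?thesis .
qed

text \<open>
  Conjugation by \<open>g\<^sub>i\<close> exchanges \<open>a\<close> and \<open>b\<close>, so \<open>a\<close> commutes with \<open>g\<^sub>i\<^sup>2\<close>; it commutes with \<open>e\<^sub>i g\<^sub>i\<close> because
  \<open>e\<^sub>i\<close> does not distinguish \<open>a\<close> from \<open>b\<close>. It is applied to \<open>a, b\<close> being \<open>t\<^sub>i\<close> and its successor, in either order.
\<close>

lemma swapped_commutes_h:
  assumes "1 \<le> i" "i < n"
    and ag: "a * g i \<approx> g i * b" and bg: "b * g i \<approx> g i * a"
    and ea: "e i * a \<approx> e i * b" and ae: "intertwines a (e i) (e i)"
  shows "intertwines a (h i) (h i)"
proof -
  have eg: "g i * e i \<approx> e i * g i" using g_e[OF assms(1,2)] by (simp add: intertwines_def)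
  have "a * (g i * g i) = a * g i * g i" by (simp add: mult.assoc)
  also have "\<dots> \<approx> g i * b * g i" by (intro eqv_left ag)
  also have "\<dots> = g i * (b * g i)" by (simp add: mult.assoc)
  also have "\<dots> \<approx> g i * (g i * a)" by (intro eqv_right bg)
  finally have 1: "intertwines a (g i * g i) (g i * g i)" by (simp add: intertwines_def mult.assoc)
  have "a * (e i * g i) = a * e i * g i" by (simp add: mult.assoc)
  also have "\<dots> \<approx> e i * a * g i" using ae by (intro eqv_left) (simp add: intertwines_def)
  also have "\<dots> = e i * (a * g i)" by (simp add: mult.assoc)
  also have "\<dots> \<approx> e i * (g i * b)" by (intro eqv_right ag)
  also have "\<dots> = e i * g i * b" by (simp add: mult.assoc)
  also have "\<dots> \<approx> g i * e i * b" by (intro eqv_left eqv_sym[OF eg])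
  also have "\<dots> = g i * (e i * b)" by (simp add: mult.assoc)
  also have "\<dots> \<approx> g i * (e i * a)" by (intro eqv_right eqv_sym[OF ea])
  also have "\<dots> = g i * e i * a" by (simp add: mult.assoc)
  also have "\<dots> \<approx> e i * g i * a" by (intro eqv_left eg)
  finally have "intertwines a (e i * g i) (e i * g i)" by (simp add: intertwines_def)
  then show ?thesis using 1 ae assms by (intro intertwines_h)
qed

lemma t_h:
  assumes "1 \<le> i" "i < n" "j \<in> {1..n}"
  shows "intertwines (t j) (h i) (h i)"
proof -
  consider "j = i" | "j = i + 1" | "j \<noteq> i" "j \<noteq> i + 1" by blast
  then show ?thesis
  proof cases
    case 1
    show ?thesis unfolding 1
      by (rule swapped_commutes_h[where b = "t (i + 1)"])
        (use assms g_t[OF assms(1,2)] e_shift t_e in \<open>auto simp: intertwines_def intro: eqv_sym\<close>)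
  next
    case 2
    show ?thesis unfolding 2
      by (rule swapped_commutes_h[where b = "t i"])
        (use assms g_t[OF assms(1,2)] e_shift t_Suc_e in \<open>auto simp: intertwines_def intro: eqv_sym\<close>)
  next
    case 3
    then have "intertwines (t j) (g i) (g i)"
      using g_t(3)[OF assms(1,2,3)] by (simp add: commute_sym)
    moreover have "intertwines (t j) (t k) (t k)" if "k \<in> {1..n}" for k
      using t_comm[OF assms(3) that] by (simp add: intertwines_def)
    ultimately show ?thesis using assms by (intro intertwines_h') auto
  qed
qed

subsection \<open>Two adjacent strands\<close>

text \<open>
  The braid relation says that \<open>g\<^sub>i g\<^sub>j\<close>, with \<open>j = i + 1\<close>, conjugates \<open>g\<^sub>i\<close> into \<open>g\<^sub>j\<close>, and it shifts the indices of
  \<open>t\<close> accordingly; so it conjugates \<open>h\<^sub>i\<close> into \<open>h\<^sub>j\<close>.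
\<close>

lemma g_g_Suc_h:
  assumes "1 \<le> i" "i + 1 < n"
  shows "g i * g (i + 1) * h i \<approx> h (i + 1) * g i * g (i + 1)"
proof -
  have "intertwines (g i * g (i + 1)) (h i) (h (i + 1))"
  proof (rule intertwines_h')
    show "intertwines (g i * g (i + 1)) (g i) (g (i + 1))"
      using braid[OF assms] by (simp add: intertwines_def mult.assoc)
    show "intertwines (g i * g (i + 1)) (t i) (t (i + 1))"
      by (rule intertwines_compose[where x' = "t i"]) (use g_t assms in auto)
    show "intertwines (g i * g (i + 1)) (t (i + 1)) (t (i + 1 + 1))"
      by (rule intertwines_compose[where x' = "t (i + 1 + 1)"]) (use g_t assms in auto)
  qed (use assms in auto)
  then show ?thesis by (simp add: intertwines_def mult.assoc)
qed

lemma g_Suc_g_h_Suc: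
  assumes "1 \<le> i" "i + 1 < n"
  shows "g (i + 1) * g i * h (i + 1) \<approx> h i * g (i + 1) * g i"
proof -
  have "intertwines (g (i + 1) * g i) (h (i + 1)) (h i)"
  proof (rule intertwines_h')
    show "intertwines (g (i + 1) * g i) (g (i + 1)) (g i)"
      using eqv_sym[OF braid[OF assms]] by (simp add: intertwines_def mult.assoc)
    show "intertwines (g (i + 1) * g i) (t (i + 1)) (t i)"
      by (rule intertwines_compose[where x' = "t i"]) (use g_t assms in auto)
    show "intertwines (g (i + 1) * g i) (t (i + 1 + 1)) (t (i + 1))"
      by (rule intertwines_compose[where x' = "t (i + 1 + 1)"]) (use g_t assms in auto)
  qed (use assms in auto)
  then show ?thesis by (simp add: intertwines_def mult.assoc)
qed

text \<open>
  Multiplying the quadratic relation by the inverse \<open>g'\<close> of \<open>g\<^sub>i\<close> and using \<open>g\<^sub>i h\<^sub>i = inverse l h\<^sub>i\<close> expresses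
  \<open>(1 - m) g' + m e\<^sub>i g'\<close> by \<open>g\<^sub>i\<close>, \<open>e\<^sub>i\<close> and \<open>h\<^sub>i\<close>; multiplying once more by \<open>e\<^sub>i\<close> eliminates \<open>e\<^sub>i g'\<close>. Division by
  \<open>1 - m\<close> gives the formula.
\<close>

definition g_inv :: "nat \<Rightarrow> 'r" where
  "g_inv i = inverse (1 - m) *s
    (g i - m *s (e i * g i) + ((1 - m) * m) *s e i - ((1 - m) * m) *s h i)"

lemma g_sq':
  assumes "1 \<le> i" "i < n"
  shows "g i * g i \<approx> (1 - m) *s 1 - m *s (e i * g i) + m *s e i + (m * inverse l) *s h i"
proof -
  have "(1 - m) *s 1 - m *s (e i * (g i - 1)) + (m * inverse l) *s h i =
      (1 - m) *s 1 - m *s (e i * g i) + m *s e i + (m * inverse l) *s h i"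
    by (simp add: right_diff_distrib scale_right_diff_distrib)
  then show ?thesis using g_sq[OF assms] by (simp only: e_def)
qed

text \<open>
  The linear algebra of the product \<open>g\<^sub>i g'\<close>, for \<open>x, w, y, z\<close> standing for \<open>1\<close>, \<open>e\<^sub>i g\<^sub>i\<close>, \<open>e\<^sub>i\<close>, \<open>h\<^sub>i\<close> and \<open>b\<close>
  for the inverse of \<open>l\<close>.
\<close>

lemma g_inv_cancellation:
  fixes a b :: 'k
  shows "(1 - a) *s x - a *s w + a *s y + (a * b) *s z
        - a *s ((1 - a) *s y - a *s w + a *s y + (a * b) *s z)
      + ((1 - a) * a) *s w - ((1 - a) * a) *s (b *s z) = (1 - a) *s x"
  by (simp only: scale_right_distrib scale_right_diff_distrib scale_left_distrib
      scale_left_diff_distrib scale_scale right_diff_distrib left_diff_distrib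
      mult.assoc mult_1_right mult_1_left) simp

lemma g_mult_g_inv:
  assumes "1 \<le> i" "i < n"
  shows "g i * g_inv i \<approx> 1"
proof -
  let ?g = "g i" and ?e = "e i" and ?h = "h i"
  have ge: "?g * ?e \<approx> ?e * ?g" using g_e[OF assms] by (simp add: intertwines_def)
  let ?sq = "(1 - m) *s 1 - m *s (?e * ?g) + m *s ?e + (m * inverse l) *s ?h"
  have "?g * (?e * ?g) = (?g * ?e) * ?g" by (simp add: mult.assoc)
  also have "\<dots> \<approx> ?e * ?g * ?g" by (intro eqv_left ge)
  also have "\<dots> = ?e * (?g * ?g)" by (simp add: mult.assoc)
  also have "\<dots> \<approx> ?e * ?sq" by (intro eqv_right g_sq' assms)
  also have "\<dots> = (1 - m) *s ?e - m *s (?e * ?e * ?g) + m *s (?e * ?e) + (m * inverse l) *s (?e * ?h)"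
    by (simp add: algebra_simps scale_mult_right)
  also have "\<dots> \<approx> (1 - m) *s ?e - m *s (?e * ?g) + m *s ?e + (m * inverse l) *s ?h"
    by (intro eqv_add eqv_diff eqv_scale eqv_refl eqv_left e_idem e_h assms)
  finally have geg: "?g * (?e * ?g) \<approx> \<dots>" .
  \<comment> \<open>\<open>1 - m\<close> times the asserted identity, so that all coefficients are polynomials in \<open>m\<close> and the inverse of \<open>l\<close>.\<close>
  have "?g * (?g - m *s (?e * ?g) + ((1 - m) * m) *s ?e - ((1 - m) * m) *s ?h) =
      ?g * ?g - m *s (?g * (?e * ?g)) + ((1 - m) * m) *s (?g * ?e) - ((1 - m) * m) *s (?g * ?h)"
    by (simp add: algebra_simps scale_mult_right)
  also have "\<dots> \<approx> ?sq - m *s ((1 - m) *s ?e - m *s (?e * ?g) + m *s ?e + (m * inverse l) *s ?h)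
      + ((1 - m) * m) *s (?e * ?g) - ((1 - m) * m) *s (inverse l *s ?h)"
    by (intro eqv_add eqv_diff eqv_scale g_sq' geg ge gh assms)
  also have "\<dots> = (1 - m) *s 1"
    by (rule g_inv_cancellation)
  finally have "g i * g_inv i \<approx> inverse (1 - m) *s ((1 - m) *s 1)"
    unfolding g_inv_def scale_mult_right by (rule eqv_scale)
  also have "\<dots> = 1" using m_neq_1 by simp
  finally show ?thesis .
qed

lemma g_inv_mult_g:
  assumes "1 \<le> i" "i < n"
  shows "g_inv i * g i \<approx> 1"
proof -
  have gg: "intertwines (g i) (g i) (g i)" by (simp add: intertwines_def)
  then have "intertwines (g i) (h i) (h i)"
    by (intro intertwines_h intertwines_mult g_e assms)
  with gg have "intertwines (g i) (g_inv i) (g_inv i)"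
    unfolding g_inv_def
    by (intro intertwines_scale intertwines_add intertwines_diff intertwines_mult g_e assms)
  then have "g_inv i * g i \<approx> g i * g_inv i" by (simp add: intertwines_def eqv_sym)
  also have "\<dots> \<approx> 1" by (rule g_mult_g_inv[OF assms])
  finally show ?thesis .
qed

text \<open>
  Inserting \<open>g\<^sub>i g'\<close> on the right, with \<open>g'\<close> the inverse of \<open>g\<^sub>i\<close>, lets the conjugation rule replace \<open>h\<^sub>i\<close> by a
  second \<open>h (i + 1)\<close>, and the relation \<open>h g h = l h\<close> then merges the two.
\<close>

lemma h_Suc_h_g_Suc:
  assumes "1 \<le> i" "i + 1 < n"
  shows "h (i + 1) * h i * g (i + 1) \<approx> h (i + 1) * g_inv i"
proof -
  let ?a = "g i" and ?b = "g (i + 1)" and ?h = "h i" and ?f = "h (i + 1)" and ?a' = "g_inv i"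
  have i: "i < n" "1 \<le> i + 1" using assms by auto
  have "?f * ?h * ?b = ?f * ?h * ?b * 1" by simp
  also have "\<dots> \<approx> ?f * ?h * ?b * (?a * ?a')"
    by (intro eqv_right eqv_sym[OF g_mult_g_inv] assms i)
  also have "\<dots> = ?f * (?h * ?b * ?a) * ?a'" by (simp add: mult.assoc)
  also have "\<dots> \<approx> ?f * (?b * ?a * ?f) * ?a'"
    by (intro eqv_middle eqv_sym[OF g_Suc_g_h_Suc] assms)
  also have "\<dots> = (?f * ?b) * (?a * ?f * ?a')" by (simp add: mult.assoc)
  also have "\<dots> \<approx> (inverse l *s ?f) * (?a * ?f * ?a')"
    using hg[of "i + 1"] assms by (intro eqv_left) auto
  also have "\<dots> = inverse l *s ((?f * ?a * ?f) * ?a')" by (simp add: mult.assoc scale_mult_left)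
  also have "\<dots> \<approx> inverse l *s ((l *s ?f) * ?a')"
    by (intro eqv_scale eqv_left hgh assms)
  also have "\<dots> = ?f * ?a'" using l_nz by (simp add: scale_mult_left)
  finally show ?thesis .
qed

text \<open>
  The conjugation rule turns the product into \<open>g_inv i * h (i + 1) * g i * g (i + 1) ^ 2\<close>, where the square is
  eliminated by the quadratic relation. In the term with \<open>e (i + 1) * g (i + 1)\<close> the idempotent is moved to
  the right and the rule is applied backwards, so that every term of the result contains at most one of
  \<open>g (i + 1)\<close>, \<open>h (i + 1)\<close>.
\<close>

lemma g_Suc_h_g_Suc:
  assumes "1 \<le> i" "i + 1 < n"
  shows "g (i + 1) * h i * g (i + 1) \<approx>
    (1 - m) *s (g_inv i * h (i + 1) * g i) - m *s (g (i + 1) * h i * e (i + 1))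
      + m *s (g_inv i * h (i + 1) * g i * e (i + 1)) + m *s (g_inv i * h (i + 1))"
proof -
  let ?a = "g i" and ?b = "g (i + 1)" and ?h = "h i" and ?f = "h (i + 1)" and ?a' = "g_inv i"
    and ?e = "e (i + 1)"
  have i: "i < n" "1 \<le> i + 1" using assms by auto
  have "?b * ?h = 1 * (?b * ?h)" by simp
  also have "\<dots> \<approx> ?a' * ?a * (?b * ?h)"
    by (intro eqv_left eqv_sym[OF g_inv_mult_g] assms i)
  also have "\<dots> = ?a' * (?a * ?b * ?h)" by (simp add: mult.assoc)
  also have "\<dots> \<approx> ?a' * (?f * ?a * ?b)" by (intro eqv_right g_g_Suc_h assms)
  finally have bh: "?b * ?h \<approx> ?a' * ?f * ?a * ?b" by (simp add: mult.assoc)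
  have "?e * ?b \<approx> ?b * ?e"
    using g_e[of "i + 1"] assms by (auto simp: intertwines_def intro: eqv_sym)
  then have "?a' * ?f * ?a * (?e * ?b) \<approx> ?a' * ?f * ?a * (?b * ?e)"
    by (intro eqv_right)
  also have "\<dots> = ?a' * ?f * ?a * ?b * ?e" by (simp add: mult.assoc)
  also have "\<dots> \<approx> ?b * ?h * ?e" by (intro eqv_left eqv_sym[OF bh])
  finally have eb: "?a' * ?f * ?a * (?e * ?b) \<approx> ?b * ?h * ?e" .
  have "?a' * ?f * ?a * ?f = ?a' * (?f * ?a * ?f)" by (simp add: mult.assoc)
  also have "\<dots> \<approx> ?a' * (l *s ?f)" by (intro eqv_right hgh assms)
  finally have f: "?a' * ?f * ?a * ?f \<approx> l *s (?a' * ?f)" by (simp add: scale_mult_right)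
  have "?b * ?h * ?b \<approx> ?a' * ?f * ?a * ?b * ?b" by (intro eqv_left bh)
  also have "\<dots> = ?a' * ?f * ?a * (?b * ?b)" by (simp add: mult.assoc)
  also have "\<dots> \<approx> ?a' * ?f * ?a *
      ((1 - m) *s 1 - m *s (?e * ?b) + m *s ?e + (m * inverse l) *s ?f)"
    using g_sq'[of "i + 1"] assms by (intro eqv_right) auto
  also have "\<dots> = (1 - m) *s (?a' * ?f * ?a) - m *s (?a' * ?f * ?a * (?e * ?b))
      + m *s (?a' * ?f * ?a * ?e) + (m * inverse l) *s (?a' * ?f * ?a * ?f)"
    by (simp add: distrib_left right_diff_distrib scale_mult_right)
  also have "\<dots> \<approx> (1 - m) *s (?a' * ?f * ?a) - m *s (?b * ?h * ?e)
      + m *s (?a' * ?f * ?a * ?e) + (m * inverse l) *s (l *s (?a' * ?f))"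
    by (intro eqv_add eqv_diff eqv_scale eqv_refl eb f)
  finally show ?thesis using l_nz by (simp add: mult.assoc)
qed

end

section \<open>Spanning by products with one last generator\<close>

context framized_BMW
begin

text \<open>
  The subalgebra on the first \<open>k\<close> strands, with all \<open>t\<close> included. It contains \<open>h 1, \<dots>, h (k - 1)\<close> by
  \<open>h_poly\<close>. Both \<open>A 0\<close> and \<open>A 1\<close> are the commutative subalgebra of the \<open>t\<close>.
\<close>

definition A :: "nat \<Rightarrow> 'r set" where
  "A k = generated (t ` {1..n} \<union> g ` {1..<k})"

lemma A_mono: "i \<le> k \<Longrightarrow> A i \<subseteq> A k"
  unfolding A_def by (intro generated_mono) auto

lemma t_A: "j \<in> {1..n} \<Longrightarrow> t j \<in> A k"
  and g_A: "1 \<le> i \<Longrightarrow> i < k \<Longrightarrow> g i \<in> A k"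
  unfolding A_def by (auto intro!: generated_gen)

lemma A_eqv: "y \<in> A k \<Longrightarrow> x \<approx> y \<Longrightarrow> x \<in> A k"
  unfolding A_def by (rule generated_eqv)

lemma one_A: "1 \<in> A k"
  by (simp add: A_def generated.one)

lemma A_mult: "x \<in> A k \<Longrightarrow> y \<in> A k \<Longrightarrow> x * y \<in> A k"
  by (simp add: A_def generated_mult)

lemma subspace_A: "subspace (A k)"
  by (simp add: A_def subspace_generated)

lemma A_scale: "x \<in> A k \<Longrightarrow> c *s x \<in> A k"
  and A_add: "x \<in> A k \<Longrightarrow> y \<in> A k \<Longrightarrow> x + y \<in> A k"
  and A_diff: "x \<in> A k \<Longrightarrow> y \<in> A k \<Longrightarrow> x - y \<in> A k"
  by (fact subspace_scale[OF subspace_A] subspace_add[OF subspace_A] subspace_diff[OF subspace_A])+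

lemma e_A: "1 \<le> i \<Longrightarrow> i < n \<Longrightarrow> e i \<in> A k"
  using t_A[of i] t_A[of "i + 1"] unfolding e_def A_def by (intro generated_avg) auto

lemma h_A:
  assumes "1 \<le> i" "i < k" "i < n"
  shows "h i \<in> A k"
  using h_poly[OF assms(1,3)]
  by (rule A_eqv[rotated]) (intro A_scale A_add A_diff A_mult one_A e_A g_A assms)

lemma g_inv_A: "1 \<le> i \<Longrightarrow> i < k \<Longrightarrow> i < n \<Longrightarrow> g_inv i \<in> A k"
  unfolding g_inv_def by (intro A_scale A_add A_diff A_mult e_A g_A h_A)

subsection \<open>Passing generators\<close>

lemma g_commutes_far: "1 \<le> i \<Longrightarrow> i + 1 < j \<Longrightarrow> j < n \<Longrightarrow> intertwines (g i) (g j) (g j)"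
  using far by (simp add: intertwines_def)

lemma g_commutes_h_far:
  assumes "1 \<le> i" "i + 1 < j" "j < n"
  shows "intertwines (g i) (h j) (h j)"
  by (rule intertwines_h') (use assms g_commutes_far g_t(3)[of i] in auto)

text \<open>
  For \<open>i < k\<close> the element \<open>g k\<close> permutes the \<open>t\<close> and commutes with the generators \<open>g j\<close> of \<open>A i\<close>.
\<close>

lemma g_past_A:
  assumes "i < k" "1 \<le> k" "k < n" "x \<in> A i"
  shows "\<exists>x'\<in>A i. g k * x \<approx> x' * g k" and "\<exists>x'\<in>A i. x * g k \<approx> g k * x'"
proof -
  let ?S = "t ` {1..n} \<union> g ` {1..<i}"
  have *: "\<exists>s'\<in>generated ?S. g k * s \<approx> s' * g k" "\<exists>s'\<in>generated ?S. s * g k \<approx> g k * s'"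
    if "s \<in> ?S" for s
  proof -
    have "(\<exists>s'\<in>generated ?S. g k * s \<approx> s' * g k) \<and> (\<exists>s'\<in>generated ?S. s * g k \<approx> g k * s')"
      using that
    proof
      assume "s \<in> t ` {1..n}"
      then obtain j where j: "s = t j" "j \<in> {1..n}" by blast
      define j' where "j' = Transposition.transpose k (k + 1) j"
      have j': "j' \<in> {1..n}" "Transposition.transpose k (k + 1) j' = j"
        using j assms by (auto simp: j'_def Transposition.transpose_def)
      have "g k * t j \<approx> t j' * g k" "t j * g k \<approx> g k * t j'"
        using eqv_sym[OF tg[OF assms(2,3) j'(1)]] tg[OF assms(2,3) j(2)] j' by (simp_all add: j'_def)
      moreover have "t j' \<in> generated ?S" using j' by (intro generated_gen) auto
      ultimately show ?thesis using j by blast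
    next
      assume s: "s \<in> g ` {1..<i}"
      then obtain j where j: "s = g j" "1 \<le> j" "j < i" by auto
      have "g j * g k \<approx> g k * g j" using j assms by (intro far) auto
      moreover have "s \<in> generated ?S" using s by (intro generated_gen) auto
      ultimately show ?thesis using j by (blast intro: eqv_sym)
    qed
    then show "\<exists>s'\<in>generated ?S. g k * s \<approx> s' * g k" "\<exists>s'\<in>generated ?S. s * g k \<approx> g k * s'"
      by blast+
  qed
  show "\<exists>x'\<in>A i. g k * x \<approx> x' * g k" "\<exists>x'\<in>A i. x * g k \<approx> g k * x'"
    using assms(4) push_left[OF *(1)] push_right[OF *(2)] unfolding A_def by blast+
qed

lemma h_past_A:
  assumes "i < k" "1 \<le> k" "k < n" "x \<in> A i"
  shows "\<exists>x'\<in>A i. h k * x \<approx> x' * h k"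
proof -
  let ?S = "t ` {1..n} \<union> g ` {1..<i}"
  have "\<exists>s'\<in>generated ?S. h k * s \<approx> s' * h k" if "s \<in> ?S" for s
  proof -
    have "intertwines s (h k) (h k)"
      using that
    proof
      assume "s \<in> t ` {1..n}"
      then show ?thesis using t_h assms by blast
    next
      assume "s \<in> g ` {1..<i}"
      then obtain j where "s = g j" "1 \<le> j" "j < i" by auto
      then show ?thesis using g_commutes_h_far assms by auto
    qed
    then have "h k * s \<approx> s * h k" by (simp add: intertwines_def eqv_sym)
    then show ?thesis using generated_gen[OF that] by blast
  qed
  from push_left[OF this] show ?thesis using assms(4) unfolding A_def by blast
qed

subsection \<open>The spanning set\<close>

text \<open>
  The candidate for \<open>A (k + 1)\<close>. Including \<open>1\<close> among the middle factors makes it contain \<open>A k\<close>.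
\<close>

definition M :: "nat \<Rightarrow> 'r set" where
  "M k = products (A k) {1, g k, h k} (A k)"

lemma subspace_M: "subspace (M k)"
  by (simp add: M_def subspace_products)

lemma M_gen: "u \<in> A k \<Longrightarrow> c \<in> {1, g k, h k} \<Longrightarrow> v \<in> A k \<Longrightarrow> u * c * v \<in> M k"
  unfolding M_def by (rule products_mem)

lemma A_subset_M: "A k \<subseteq> M k"
  using M_gen[of _ k 1 1] one_A by force

lemma M_eqv: "y \<in> M k \<Longrightarrow> x \<approx> y \<Longrightarrow> x \<in> M k"
proof (rule subspace_eqv_closed[OF subspace_M])
  show "I \<subseteq> M k"
    using A_subset_M[of k] generated.ideal unfolding A_def by blast
qed

lemma M_bimodule:
  assumes "p \<in> A k" "x \<in> M k" "q \<in> A k"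
  shows "p * x * q \<in> M k"
  using assms(2) unfolding M_def
proof (rule products_induct)
  show "subspace {x. p * x * q \<in> products (A k) {1, g k, h k} (A k)}"
    by (intro subspace_two_sided_preimage subspace_products)
  fix u c v assume "u \<in> A k" "c \<in> {1, g k, h k}" "v \<in> A k"
  then have "(p * u) * c * (v * q) \<in> M k" by (intro M_gen A_mult assms)
  then show "p * (u * c * v) * q \<in> products (A k) {1, g k, h k} (A k)"
    by (simp add: M_def mult.assoc)
qed

lemma M_add: "x \<in> M k \<Longrightarrow> y \<in> M k \<Longrightarrow> x + y \<in> M k"
  and M_diff: "x \<in> M k \<Longrightarrow> y \<in> M k \<Longrightarrow> x - y \<in> M k"
  and M_scale: "x \<in> M k \<Longrightarrow> c *s x \<in> M k"
  by (fact subspace_add[OF subspace_M] subspace_diff[OF subspace_M] subspace_scale[OF subspace_M])+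

lemma h_M: "h k \<in> M k"
  using M_gen[of 1 k _ 1] one_A by force

lemma g_g_M:
  assumes "1 \<le> k" "k < n"
  shows "g k * g k \<in> M k"
proof (rule M_eqv[OF _ g_sq'[OF assms]])
  have "1 \<in> M k" "e k \<in> M k" "e k * g k \<in> M k"
    using A_subset_M one_A[of k] e_A[OF assms] M_gen[of "e k" k "g k" 1] by force+
  then show "(1 - m) *s 1 - m *s (e k * g k) + m *s e k + (m * inverse l) *s h k \<in> M k"
    by (intro M_add M_diff M_scale h_M)
qed

lemma h_g_M:
  assumes "1 \<le> k" "k < n"
  shows "h k * g k \<in> M k"
  by (rule M_eqv[OF M_scale[OF h_M] hg[OF assms]])

text \<open>
  The local reduction: two last generators with an element of the previous level between them collapse
  to one. It consists of the braid relation, the two conjugation rules, and the products computed above.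
\<close>

lemma adjacent_products_M:
  assumes "1 \<le> i" "i + 1 < n" and c: "c \<in> {g (i + 1), h (i + 1)}" and c': "c' \<in> {1, g i, h i}"
  shows "c * c' * g (i + 1) \<in> M (i + 1)"
proof -
  let ?k = "i + 1"
  have i: "i < n" "1 \<le> ?k" "i < ?k" using assms by auto
  have A: "g i \<in> A ?k" "h i \<in> A ?k" "g_inv i \<in> A ?k" "e ?k \<in> A ?k"
    using assms(1,2) i by (auto intro: g_A h_A g_inv_A e_A)
  have mid: "u * g ?k * v \<in> M ?k" "u * h ?k * v \<in> M ?k" if "u \<in> A ?k" "v \<in> A ?k" for u v
    using that by (auto intro: M_gen)
  have right: "u * h ?k \<in> M ?k" and left: "g ?k * u \<in> M ?k" and left_h: "h ?k * u \<in> M ?k"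
    if "u \<in> A ?k" for u
    using mid[OF that one_A] mid[OF one_A that] by simp_all
  have "g ?k * g i * g ?k \<in> M ?k"
    using M_eqv[OF mid(1)[OF A(1) A(1)] eqv_sym[OF braid[OF assms(1,2)]]] by simp
  moreover have "h ?k * g i * g ?k \<in> M ?k"
    using M_eqv[OF mid(1)[OF A(1) A(2)] eqv_sym[OF g_g_Suc_h[OF assms(1,2)]]] by simp
  moreover have "h ?k * h i * g ?k \<in> M ?k"
    using M_eqv[OF left_h[OF A(3)] h_Suc_h_g_Suc[OF assms(1,2)]] by simp
  moreover have "g ?k * h i * g ?k \<in> M ?k"
  proof (rule M_eqv[OF _ g_Suc_h_g_Suc[OF assms(1,2)]])
    have "g_inv i * h ?k * g i \<in> M ?k" by (intro mid A)
    moreover have "g ?k * h i * e ?k \<in> M ?k"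
      using left[OF A_mult[OF A(2,4)]] by (simp add: mult.assoc)
    moreover have "g_inv i * h ?k * g i * e ?k \<in> M ?k"
      using mid(2)[OF A(3) A_mult[OF A(1,4)]] by (simp add: mult.assoc)
    moreover have "g_inv i * h ?k \<in> M ?k" by (intro right A)
    ultimately show "(1 - m) *s (g_inv i * h ?k * g i) - m *s (g ?k * h i * e ?k)
      + m *s (g_inv i * h ?k * g i * e ?k) + m *s (g_inv i * h ?k) \<in> M ?k"
      by (intro M_add M_diff M_scale)
  qed
  moreover have "g ?k * g ?k \<in> M ?k" "h ?k * g ?k \<in> M ?k"
    using g_g_M h_g_M assms(2) i by auto
  ultimately show ?thesis using c c' by auto
qed

text \<open>
  With \<open>A k\<close> decomposed over \<open>A i\<close>, in a product \<open>c v (g k)\<close> with \<open>v\<close> in \<open>A k\<close> the outer factors of \<open>v\<close> move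
  to the outside, past \<open>c\<close> and past \<open>g k\<close>. Only a product \<open>c c' (g k)\<close> with \<open>c'\<close> in \<open>C\<close> remains.
\<close>

lemma M_mult_g:
  assumes k: "1 \<le> k" "k < n" and "i < k" and dec: "A k \<subseteq> products (A i) C (A i)"
    and C: "\<And>c c'. c \<in> {g k, h k} \<Longrightarrow> c' \<in> C \<Longrightarrow> c * c' * g k \<in> M k"
    and x: "x \<in> M k"
  shows "x * g k \<in> M k"
proof -
  have main: "c * v * g k \<in> M k" if c: "c \<in> {g k, h k}" and "v \<in> A k" for c v
  proof -
    from that dec have "v \<in> products (A i) C (A i)" by blast
    then show ?thesis
    proof (rule products_induct)
      show "subspace {v. c * v * g k \<in> M k}"
        by (intro subspace_two_sided_preimage subspace_M)
      fix p c' q assume p: "p \<in> A i" and c': "c' \<in> C" and q: "q \<in> A i"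
      obtain p' where p': "p' \<in> A i" "c * p \<approx> p' * c"
        using c g_past_A(1)[OF \<open>i < k\<close> k p] h_past_A[OF \<open>i < k\<close> k p] by auto
      obtain q' where q': "q' \<in> A i" "q * g k \<approx> g k * q'"
        using g_past_A(2)[OF \<open>i < k\<close> k q] by blast
      have "c * (p * c' * q) * g k = (c * p) * (c' * (q * g k))" by (simp add: mult.assoc)
      also have "\<dots> \<approx> (p' * c) * (c' * (g k * q'))"
        by (intro eqv_mult eqv_refl p' q')
      also have "\<dots> = p' * (c * c' * g k) * q'" by (simp add: mult.assoc)
      finally have "c * (p * c' * q) * g k \<approx> p' * (c * c' * g k) * q'" .
      moreover have "p' * (c * c' * g k) * q' \<in> M k"
        using A_mono[of i k] \<open>i < k\<close> p' q' C[OF c c'] by (intro M_bimodule[of p' k "c * c' * g k" q']) auto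
      ultimately show "c * (p * c' * q) * g k \<in> M k"
        by (rule M_eqv[rotated])
    qed
  qed
  have "x \<in> products (A k) {1, g k, h k} (A k)" using x by (simp add: M_def)
  then show ?thesis
  proof (rule products_induct)
    show "subspace {x. x * g k \<in> M k}"
      using subspace_two_sided_preimage[OF subspace_M, of 1 "g k" k] by simp
    fix u c v assume u: "u \<in> A k" and c: "c \<in> {1, g k, h k}" and v: "v \<in> A k"
    show "u * c * v * g k \<in> M k"
    proof (cases "c = 1")
      case True
      then show ?thesis
        using M_gen[OF A_mult[OF u v] _ one_A, of "g k"] by simp
    next
      case False
      then have "u * (c * v * g k) * 1 \<in> M k"
        using c v by (intro M_bimodule main u one_A) auto
      then show ?thesis by (simp add: mult.assoc)
    qed
  qed
qed

lemma A_Suc_subset_M_step: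
  assumes "1 \<le> k" "k < n" "i < k" "A k \<subseteq> products (A i) C (A i)"
    and "\<And>c c'. c \<in> {g k, h k} \<Longrightarrow> c' \<in> C \<Longrightarrow> c * c' * g k \<in> M k"
  shows "A (k + 1) \<subseteq> M k"
  unfolding A_def
proof (rule generated_subset[OF subspace_M])
  show "I \<subseteq> M k"
    using A_subset_M[of k] generated.ideal unfolding A_def by blast
  show "1 \<in> M k" using A_subset_M one_A by blast
  fix x s assume x: "x \<in> M k" and "s \<in> t ` {1..n} \<union> g ` {1..<k + 1}"
  then have "s \<in> A k \<or> s = g k" by (auto simp: t_A g_A less_Suc_eq)
  then show "x * s \<in> M k"
    using M_bimodule[OF one_A x, of s] M_mult_g[OF assms x] by auto
qed

text \<open>
  Induction on \<open>k\<close>: the statement for \<open>k\<close> is the decomposition of \<open>A (k + 1)\<close> that the next step consumes.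
\<close>

lemma A_Suc_subset_M:
  assumes "1 \<le> k" "k < n"
  shows "A (k + 1) \<subseteq> M k"
  using assms
proof (induction k rule: nat_induct_at_least)
  case base
  \<comment> \<open>With no generator below the first, the middle factor is \<open>1\<close> and the inner level is \<open>A 0\<close>.\<close>
  have "A 1 = A 0" by (simp add: A_def)
  have "A 1 \<subseteq> products (A 0) {1} (A 0)"
  proof
    fix x assume "x \<in> A 1"
    then show "x \<in> products (A 0) {1} (A 0)"
      using products_mem[of x "A 0" 1 "{1}" 1] one_A \<open>A 1 = A 0\<close> by simp
  qed
  then show ?case
    using base g_g_M[of 1] h_g_M[of 1]
    by (intro A_Suc_subset_M_step[of 1 0 "{1}"]) auto
next
  case (Suc k)
  then show ?case
    using adjacent_products_M[of k]
    by (intro A_Suc_subset_M_step[of "Suc k" k "{1, g k, h k}"]) (auto simp: M_def)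
qed

subsection \<open>Finiteness\<close>

lemma finite_mod_one: "finite_mod {1}"
  unfolding finite_mod_def by (intro exI[of _ "{1}"]) (auto intro: span_base)

text \<open>
  The monomials with exponents below \<open>d\<close> span, since the \<open>t\<close> commute and have order dividing \<open>d\<close>.
\<close>

lemma finite_mod_t:
  assumes "j \<le> n"
  shows "finite_mod (generated (t ` {1..j}))"
  using assms
proof (induction j)
  case 0
  have "generated {} \<subseteq> span ({1} \<union> I)"
    by (rule generated_subset) (auto intro: span_base)
  then show ?case unfolding finite_mod_def by (intro exI[of _ "{1}"]) simp
next
  case (Suc j)
  let ?U = "generated (t ` {1..j})" and ?C = "(\<lambda>s. t (Suc j) ^ s) ` {..<d}"
  let ?N = "products ?U ?C {1}"
  have mem: "u * t (Suc j) ^ s \<in> ?N" if "u \<in> ?U" "s < d" for u s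
    using products_mem[of u ?U "t (Suc j) ^ s" ?C 1 "{1}"] that by simp
  have U: "?U \<subseteq> ?N" using mem[of _ 0] d_pos by auto
  then have I: "I \<subseteq> ?N" using generated.ideal by blast
  have "generated (t ` {1..Suc j}) \<subseteq> ?N"
  proof (rule generated_subset[OF subspace_products I])
    show "1 \<in> ?N" using U generated.one by blast
    fix x r assume "x \<in> ?N" and r: "r \<in> t ` {1..Suc j}"
    from this(1) show "x * r \<in> ?N"
    proof (rule products_induct)
      show "subspace {x. x * r \<in> ?N}"
        using subspace_two_sided_preimage[OF subspace_products, of 1 r] by simp
      fix u c v assume u: "u \<in> ?U" and c: "c \<in> ?C" and v: "v \<in> {1 :: 'r}"
      obtain s where s: "c = t (Suc j) ^ s" "s < d" using c by blast
      have "u * t (Suc j) ^ s * r \<in> ?N"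
      proof (cases "r = t (Suc j)")
        case True
        then have eq: "u * t (Suc j) ^ s * r = u * t (Suc j) ^ Suc s"
          by (simp only: power_Suc2 mult.assoc)
        show ?thesis
        proof (cases "Suc s < d")
          case True
          then show ?thesis unfolding eq by (rule mem[OF u])
        next
          case False
          \<comment> \<open>The power wraps around to the exponent \<open>0\<close>.\<close>
          then have "Suc s = d" using s by simp
          then have "u * t (Suc j) ^ Suc s \<approx> u * 1"
            using t_pow[of "Suc j"] Suc.prems by (intro eqv_right) auto
          moreover have "u * 1 \<in> ?N" using U u by auto
          ultimately show ?thesis
            unfolding eq by (rule subspace_eqv_closed[OF subspace_products I, rotated])
        qed
      next
        case False
        then obtain i where i: "r = t i" "i \<in> {1..j}" using r by (auto simp: le_Suc_eq)
        have "intertwines r (t (Suc j)) (t (Suc j))"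
          unfolding intertwines_def i(1) using i(2) Suc.prems by (intro t_comm) auto
        then have "t (Suc j) ^ s * r \<approx> r * t (Suc j) ^ s"
          using intertwines_power[of r "t (Suc j)" "t (Suc j)" s]
          by (simp add: intertwines_def eqv_sym)
        then have "u * (t (Suc j) ^ s * r) \<approx> u * (r * t (Suc j) ^ s)"
          by (rule eqv_right)
        moreover have "u * r * t (Suc j) ^ s \<in> ?N"
          using i s by (intro mem generated.mult_gen u) auto
        ultimately show ?thesis
          unfolding mult.assoc by (rule subspace_eqv_closed[OF subspace_products I, rotated])
      qed
      then show "u * c * v * r \<in> ?N" using s v by simp
    qed
  qed
  moreover have "finite_mod ?N"
    using Suc by (intro finite_mod_products finite_mod_one) auto
  ultimately show ?case by (rule finite_mod_subset[rotated])
qed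

theorem finite_mod_A:
  assumes "k \<le> n"
  shows "finite_mod (A k)"
  using assms
proof (induction k)
  case 0
  show ?case using finite_mod_t[of n] by (simp add: A_def)
next
  case (Suc k)
  show ?case
  proof (cases "k = 0")
    case True
    then show ?thesis using finite_mod_t[of n] by (simp add: A_def)
  next
    case False
    have "A (Suc k) \<subseteq> M k" using A_Suc_subset_M[of k] False Suc.prems by simp
    moreover have "finite_mod (M k)"
      unfolding M_def using Suc by (intro finite_mod_products) auto
    ultimately show ?thesis by (rule finite_mod_subset[rotated])
  qed
qed

end

section \<open>Quotients of free algebras\<close>

lemma nc_poly_induct [case_names zero add]:
  fixes p :: "('x, 'a::comm_ring_1) nc_poly"
  assumes "P 0" and "\<And>w a q. P q \<Longrightarrow> P (Poly_Mapping.single w a + q)"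
  shows "P p"
proof (induction p rule: update_induct)
  case (update q w a)
  have "Poly_Mapping.update w a q = Poly_Mapping.single w a + q"
    using update(1)
    by (intro poly_mapping_eqI)
      (auto simp: lookup_update lookup_add lookup_single in_keys_iff when_def)
  then show ?case using assms(2)[OF update(3)] by simp
qed (fact assms(1))

lemma scalar_central: "p * scalar c = scalar c * p"
  by (induction p rule: nc_poly_induct)
    (simp_all add: scalar_def distrib_left distrib_right mult_single mult.commute)

text \<open>
  The retraction of the free algebra on all letters onto the subalgebra on the letters \<open>X\<close>, killing the
  other letters. It is an algebra homomorphism, so the preimage of an ideal of the subalgebra is an ideal
  of the full type with the same quotient. This replaces reasoning relative to a carrier.
\<close>

lift_definition restrict_letters :: "'x set \<Rightarrow> ('x, 'a::comm_ring_1) nc_poly \<Rightarrow> ('x, 'a) nc_poly"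
  is "\<lambda>X p w. p w when set (letters w) \<subseteq> X"
  by (rule finite_subset[of _ "{x. f x \<noteq> 0}" for f]) auto

lemma restrict_letters_add:
  "restrict_letters X (p + q) = restrict_letters X p + restrict_letters X q"
  by (intro poly_mapping_eqI) (simp add: restrict_letters.rep_eq lookup_add when_add_distrib)

lemma restrict_letters_0 [simp]: "restrict_letters X 0 = 0"
  by (intro poly_mapping_eqI) (simp add: restrict_letters.rep_eq)

lemma restrict_letters_single:
  "restrict_letters X (Poly_Mapping.single w a) =
    (if set (letters w) \<subseteq> X then Poly_Mapping.single w a else 0)"
  by (intro poly_mapping_eqI) (auto simp: restrict_letters.rep_eq lookup_single when_def)

lemma restrict_letters_mult:
  "restrict_letters X (p * q) = restrict_letters X p * restrict_letters X q"
proof (induction p rule: nc_poly_induct)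
  case (add w a p)
  have "restrict_letters X (Poly_Mapping.single w a * q) =
      restrict_letters X (Poly_Mapping.single w a) * restrict_letters X q"
    by (induction q rule: nc_poly_induct)
      (auto simp: distrib_left mult_single restrict_letters_add restrict_letters_single
        plus_free_monoid_def)
  then show ?case using add by (simp add: distrib_right restrict_letters_add)
qed simp

lemma restrict_letters_scalar_mult:
  "restrict_letters X (scalar c * p) = scalar c * restrict_letters X p"
  by (simp add: restrict_letters_mult scalar_def restrict_letters_single zero_free_monoid_def)

lemma restrict_letters_carrier: "restrict_letters X p \<in> carrier (free_algebra X)"
  by (auto simp: in_keys_iff restrict_letters.rep_eq)

lemma restrict_letters_id:
  "p \<in> carrier (free_algebra X) \<Longrightarrow> restrict_letters X p = p"
  by (intro poly_mapping_eqI) (auto simp: restrict_letters.rep_eq when_def in_keys_iff)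

lemma vector_space_scalar:
  "vector_space (\<lambda>c (p :: ('x, 'a::field) nc_poly). scalar c * p)"
  by unfold_locales (simp_all add: distrib_left distrib_right scalar_add scalar_mult scalar_1 mult.assoc)

lemma algebra_mod_ideal_restrict_letters:
  fixes I :: "('x, 'a::field) nc_poly set"
  assumes "ideal I (free_algebra X)"
  shows "algebra_mod_ideal (\<lambda>c p. scalar c * p) {p. restrict_letters X p \<in> I}"
proof -
  interpret I: ideal I "free_algebra X" by fact
  interpret vector_space "\<lambda>c (p :: ('x, 'a) nc_poly). scalar c * p" by (rule vector_space_scalar)
  have zero: "0 \<in> I" using additive_subgroup.zero_closed[OF I.is_additive_subgroup] by simp
  have add: "p + q \<in> I" if "p \<in> I" "q \<in> I" for p q using additive_subgroup.a_closed[OF I.is_additive_subgroup that] by simp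
  have left: "p * q \<in> I" if "q \<in> I" "p \<in> carrier (free_algebra X)" for p q
    using I.I_l_closed[OF that] by simp
  have right: "q * p \<in> I" if "q \<in> I" "p \<in> carrier (free_algebra X)" for p q
    using I.I_r_closed[OF that] by simp
  show ?thesis
  proof (unfold_locales, goal_cases)
    case 1
    then show ?case by (simp add: mult.assoc)
  next
    case (2 x c y)
    show ?case by (simp add: mult.assoc[symmetric] scalar_central)
  next
    case 3
    show ?case
      unfolding subspace_def
      by (simp add: restrict_letters_add restrict_letters_scalar_mult zero add left
          free_algebra_closed(1) del: free_algebra_simps(1))
  next
    case (4 i x)
    then show ?case by (simp add: restrict_letters_mult left restrict_letters_carrier del: free_algebra_simps(1))
  next
    case (5 i x)
    then show ?case by (simp add: restrict_letters_mult right restrict_letters_carrier del: free_algebra_simps(1))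
  qed
qed

text \<open>
  The map \<open>\<phi>\<close>, restriction followed by the coset map, is linear, onto, and vanishes on the preimage ideal; it
  carries a finite spanning set modulo that ideal to a spanning set of the quotient.
\<close>

lemma fin_dim_quotient_algebra:
  fixes I :: "('x, 'a::field) nc_poly set"
  assumes I: "ideal I (free_algebra X)"
    and fin: "algebra_mod_ideal.finite_mod (\<lambda>c p. scalar c * p) {p. restrict_letters X p \<in> I} UNIV"
  shows "vectorspace.fin_dim class_ring (quotient_algebra (free_algebra X) I)"
proof -
  let ?A = "free_algebra X :: ('a, ('x, 'a) nc_poly) module"
  let ?J = "{p. restrict_letters X p \<in> I}"
  define \<phi> where "\<phi> p = I +>\<^bsub>?A\<^esub> restrict_letters X p" for p
  interpret I: ideal I ?A by fact
  interpret Q: vectorspace "class_ring :: 'a ring" "quotient_algebra ?A I"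
    by (rule vectorspace_quotient_algebra[OF I])
  interpret J: algebra_mod_ideal "\<lambda>c (p :: ('x, 'a) nc_poly). scalar c * p" ?J
    by (rule algebra_mod_ideal_restrict_letters[OF I])
  obtain F where F: "finite F" "UNIV = J.span (F \<union> ?J)"
    using fin unfolding J.finite_mod_def by blast
  have carrier_Q: "carrier (quotient_algebra ?A I) = range \<phi>"
  proof -
    have "carrier (quotient_algebra ?A I) = {I +>\<^bsub>?A\<^esub> p |p. p \<in> carrier ?A}"
      unfolding quotient_algebra_def FactRing_def A_RCOSETS_def RCOSETS_def a_r_coset_def by auto
    also have "\<dots> = range \<phi>"
    proof
      show "{I +>\<^bsub>?A\<^esub> p |p. p \<in> carrier ?A} \<subseteq> range \<phi>"
      proof
        fix C assume "C \<in> {I +>\<^bsub>?A\<^esub> p |p. p \<in> carrier ?A}"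
        then obtain p where p: "C = I +>\<^bsub>?A\<^esub> p" "p \<in> carrier ?A" by blast
        then have "C = \<phi> p" unfolding \<phi>_def by (simp only: restrict_letters_id)
        then show "C \<in> range \<phi>" by blast
      qed
      show "range \<phi> \<subseteq> {I +>\<^bsub>?A\<^esub> p |p. p \<in> carrier ?A}"
        unfolding \<phi>_def using restrict_letters_carrier by blast
    qed
    finally show ?thesis .
  qed
  have zero_I: "0 \<in> I"
    using additive_subgroup.zero_closed[OF I.is_additive_subgroup] by simp
  have zero: "\<phi> p = \<zero>\<^bsub>quotient_algebra ?A I\<^esub>" if "p \<in> ?J" for p
    using that I.a_rcos_const[of "restrict_letters X p"]
    by (simp add: \<phi>_def quotient_algebra_def FactRing_def)
  have add: "\<phi> (p + q) = \<phi> p \<oplus>\<^bsub>quotient_algebra ?A I\<^esub> \<phi> q" for p q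
    using I.a_rcos_sum[OF restrict_letters_carrier restrict_letters_carrier, of p q]
    by (simp add: \<phi>_def quotient_algebra_def FactRing_def restrict_letters_add)
  have smult: "\<phi> (scalar c * p) = c \<odot>\<^bsub>quotient_algebra ?A I\<^esub> \<phi> p" for c p
    unfolding \<phi>_def restrict_letters_scalar_mult
    by (rule smult_quotient_algebra[OF I restrict_letters_carrier, symmetric])
  have F_carrier: "\<phi> ` F \<subseteq> carrier (quotient_algebra ?A I)"
    unfolding carrier_Q by blast
  let ?S = "Q.span (\<phi> ` F)"
  interpret S: submodule "class_ring :: 'a ring" ?S "quotient_algebra ?A I"
    by (rule Q.span_is_submodule[OF F_carrier])
  have "\<phi> p \<in> ?S" for p
  proof (rule J.span_induct[of p "F \<union> ?J"])
    show "p \<in> J.span (F \<union> ?J)" using F(2) by blast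
    show "J.subspace {p. \<phi> p \<in> ?S}"
      unfolding J.subspace_def mem_Collect_eq add smult
      using zero[of 0] S.zero_closed S.m_closed S.smult_closed zero_I by simp
    fix q assume "q \<in> F \<union> ?J"
    then show "\<phi> q \<in> ?S"
      using zero[of q] S.zero_closed Q.in_own_span[OF F_carrier] by auto
  qed
  then have "Q.span (\<phi> ` F) = carrier (quotient_algebra ?A I)"
    using Q.span_is_subset2[OF F_carrier] unfolding carrier_Q by blast
  then show ?thesis
    unfolding Q.fin_dim_def using F(1) F_carrier by blast
qed

section \<open>The framization of the BMW algebra\<close>

lemma l_var_nonzero: "l_var \<noteq> 0"
  and m_var_nonzero: "m_var \<noteq> 0"
  and m_var_neq_1: "m_var \<noteq> 1"
proof -
  show "l_var \<noteq> 0" "m_var \<noteq> 0" by (simp_all add: l_var_def m_var_def)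
  have "m_var = 1 \<longleftrightarrow> [:0, 1 :: complex poly:] = 1"
    unfolding m_var_def by (metis to_fract_1 to_fract_eq_iff)
  then show "m_var \<noteq> 1" by (simp add: one_pCons)
qed

lemma of_nat_ground: "of_nat k = (to_fract (of_nat k) :: ground)"
  by (induction k) simp_all

lemma generated_vars:
  fixes I :: "('x, 'a::field) nc_poly set"
  assumes "algebra_mod_ideal (\<lambda>c p. scalar c * p) I"
  shows "algebra_mod_ideal.generated (\<lambda>c p. scalar c * p) I (range var) = UNIV"
proof -
  interpret algebra_mod_ideal "\<lambda>c (p :: ('x, 'a) nc_poly). scalar c * p" I by fact
  have word: "Poly_Mapping.single (Word xs) 1 \<in> generated (range var)" for xs :: "'x list"
  proof (induction xs rule: rev_induct)
    case Nil
    show ?case using generated.one by (metis single_one zero_free_monoid_def)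
  next
    case (snoc x xs)
    have "Poly_Mapping.single (Word xs) 1 * var x = (Poly_Mapping.single (Word (xs @ [x])) 1 :: ('x, 'a) nc_poly)"
      by (simp add: var_def mult_single plus_free_monoid_def)
    then show ?case using generated.mult_gen[OF snoc, of "var x"] by simp
  qed
  have "p \<in> generated (range var)" for p
  proof (induction p rule: nc_poly_induct)
    case zero
    show ?case by (rule subspace_0[OF subspace_generated])
  next
    case (add w a q)
    have "Poly_Mapping.single w a = scalar a * Poly_Mapping.single (Word (letters w)) 1"
      by (simp add: scalar_def mult_single)
    then show ?case using add generated.add generated.scale[OF word] by metis
  qed
  then show ?thesis by blast
qed

theorem corollary1:
  fixes d n :: nat and y :: "nat \<Rightarrow> ground"
  assumes "d > 0" and "n > 0"
    and "y 0 = y_bmw"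
  shows "vectorspace.fin_dim class_ring (F_alg d n y)"
proof -
  let ?A = "free_algebra (F_gens n) :: (ground, F_poly) module"
  let ?R = "{p - q |p q. (p, q) \<in> F_rels d n y}"
  let ?I = "Idl\<^bsub>?A\<^esub> ?R"
  let ?J = "{p. restrict_letters (F_gens n) p \<in> ?I}"
  interpret I: ideal ?I ?A by (rule F_ideal)
  interpret algebra_mod_ideal "\<lambda>c (p :: F_poly). scalar c * p" ?J
    by (rule algebra_mod_ideal_restrict_letters[OF F_ideal])
  have R_I: "?R \<subseteq> ?I"
    unfolding genideal_def by blast
  have rel: "eqv p q" if "(p, q) \<in> F_rels d n y" for p q
  proof -
    have "p - q \<in> ?R" using that by blast
    then have "p - q \<in> ?I" "p - q \<in> carrier ?A"
      using R_I additive_subgroup.a_subset[OF I.is_additive_subgroup] by blast+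
    then show ?thesis unfolding eqv_def using restrict_letters_id[of "p - q"] by simp
  qed
  interpret framized_BMW "\<lambda>c (p :: F_poly). scalar c * p" ?J l_var m_var d n gX hX tX
  proof
    show "l_var \<noteq> 0" "m_var \<noteq> 0" "m_var \<noteq> 1" "d > 0"
      using l_var_nonzero m_var_nonzero m_var_neq_1 assms(1) by blast+
    show "of_nat d \<noteq> (0 :: ground)" using assms(1) by (simp add: of_nat_ground)
  next
    fix i assume "1 \<le> i" "i + 1 < n"
    then show "eqv (gX i * gX (i + 1) * gX i) (gX (i + 1) * gX i * gX (i + 1))"
      "eqv (hX (i + 1) * gX i * hX (i + 1)) (scalar l_var * hX (i + 1))"
      by (intro rel F_rels.intros; simp)+
  next
    fix i j assume "1 \<le> i" "i + 1 < j" "j < n"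
    then show "eqv (gX i * gX j) (gX j * gX i)"
      by (intro rel F_rels.intros) auto
  next
    fix i assume i: "1 \<le> i" "i < n"
    then show "eqv (gX i * hX i) (scalar (inverse l_var) * hX i)"
      "eqv (tX i * hX i) (tX (i + 1) * hX i)"
      by (intro rel F_rels.intros; simp)+
    have "eqv (gX i ^ 2) (scalar (1 - m_var) - scalar m_var * eX d i * (gX i - 1)
        + scalar (m_var * inverse l_var) * hX i)"
      using i by (intro rel F_rels.g_sq) auto
    then show "eqv (gX i * gX i) (scalar (1 - m_var) * 1
        - scalar m_var * (avg d (tX i) (tX (i + 1)) * (gX i - 1))
        + scalar (m_var * inverse l_var) * hX i)"
      by (simp add: power2_eq_square eX_def avg_def mult.assoc)
  next
    fix j assume "j \<in> {1..n}"
    then show "eqv (tX j ^ d) 1" by (intro rel F_rels.intros)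
  next
    fix i j assume "i \<in> {1..n}" "j \<in> {1..n}"
    then show "eqv (tX i * tX j) (tX j * tX i)" by (intro rel F_rels.intros)
  next
    fix i j assume "1 \<le> i" "i < n" "j \<in> {1..n}"
    then show "eqv (tX j * gX i) (gX i * tX (Transposition.transpose i (i + 1) j))"
      by (intro rel F_rels.tg) auto
  qed
  have var_A: "var x \<in> A n" for x
  proof (cases "x \<in> F_gens n")
    case True
    then consider i where "x = Gen_g i" "1 \<le> i" "i < n" | i where "x = Gen_h i" "1 \<le> i" "i < n"
      | i where "x = Gen_t i" "i \<in> {1..n}"
      unfolding F_gens_def by (elim UnE imageE) (simp_all, linarith+)
    then show ?thesis by cases (simp_all only: g_A h_A t_A)
  next
    case False
    \<comment> \<open>A letter with index out of range vanishes modulo \<open>?J\<close>.\<close>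
    then have "restrict_letters (F_gens n) (var x :: F_poly) = 0"
      by (simp add: var_def restrict_letters_single)
    then have "var x \<in> ?J"
      using additive_subgroup.zero_closed[OF I.is_additive_subgroup] by simp
    then show ?thesis unfolding A_def by (rule generated.ideal)
  qed
  have "generated (range var) \<subseteq> A n"
  proof (rule generated_subset)
    show "?J \<subseteq> A n" unfolding A_def using generated.ideal by blast
  qed (use var_A in \<open>auto intro: subspace_A one_A A_mult\<close>)
  then have "A n = UNIV"
    using generated_vars[OF algebra_mod_ideal_axioms] by blast
  then have "finite_mod UNIV"
    using finite_mod_A[of n] by simp
  then show ?thesis
    unfolding F_alg_def presented_algebra_def by (rule fin_dim_quotient_algebra[OF F_ideal])
qed

end
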